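(* Let $D\in\mathcal{M}_r(\mathbb{C})$ be diagonal and invertible. If $D$ has two eigenvalues with distinct moduli, then there exists $T\in\mathcal{S}(D)$ such that the map $R_T:(0,1)\to\mathcal{M}_r(\mathbb{C})$, $R_T(\lambda)=\Delta_\lambda^\infty(T)$, is not constant.
   Context: $\mathcal{M}_r(\mathbb{C})$ is the space of complex $r\times r$ matrices. For $T\in\mathcal{M}_r(\mathbb{C})$ with polar decomposition $T=U|T|$, $|T|=(T^*T)^{1/2}$, and $\lambda\in(0,1)$, the $\lambda$-Aluthge transform is $\Delta_\lambda(T)=|T|^\lambda U|T|^{1-\lambda}$, with iterates $\Delta_\lambda^0(T)=T$, $\Delta_\lambda^n(T)=\Delta_\lambda(\Delta_\lambda^{n-1}(T))$. $\Delta_\lambda^\infty(T)=\lim_{n\to\infty}\Delta_\lambda^n(T)$, a limit which exists for every diagonalizable $T$. $\mathcal{S}(D)=\{SDS^{-1}:S\text{ invertible}\}$ is the similarity orbit of $D$. *)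

theory Defs
  imports "HOL-Analysis.Analysis"
begin

definition mat_adj :: "complex^'n^'m \<Rightarrow> complex^'m^'n" where
  "mat_adj A = transpose (map_matrix cnj A)"

definition unitary_mat :: "complex^'n^'n \<Rightarrow> bool" where
  "unitary_mat V \<longleftrightarrow> mat_adj V ** V = mat 1 \<and> V ** mat_adj V = mat 1"

definition diag_of :: "('n \<Rightarrow> 'a::zero) \<Rightarrow> 'a^'n^'n" where
  "diag_of d = (\<chi> i j. if i = j then d i else 0)"

definition is_diagonal :: "('a::zero)^'n^'n \<Rightarrow> bool" where
  "is_diagonal A \<longleftrightarrow> (\<forall>i j. i \<noteq> j \<longrightarrow> A $ i $ j = 0)"

definition is_eigenvalue :: "complex^'n^'n \<Rightarrow> complex \<Rightarrow> bool" where
  "is_eigenvalue A c \<longleftrightarrow> (\<exists>v. v \<noteq> 0 \<and> A *v v = c *s v)"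

definition similarity_orbit :: "complex^'n^'n \<Rightarrow> (complex^'n^'n) set" where
  "similarity_orbit D = {S ** D ** matrix_inv S | S. invertible S}"

(* Real power of a positive semidefinite matrix by the functional calculus:
   diagonalize it unitarily and raise the eigenvalues to the power s.  The result
   does not depend on the diagonalization (mat_powr_eq).  Only meant for positive
   semidefinite P and s > 0, where 0 powr s = 0 is the usual convention. *)
definition mat_powr :: "complex^'n^'n \<Rightarrow> real \<Rightarrow> complex^'n^'n" where
  "mat_powr P s = (THE Q. \<exists>V (d :: 'n \<Rightarrow> real). unitary_mat V \<and> (\<forall>i. 0 \<le> d i) \<and>
      P = V ** diag_of (\<lambda>i. complex_of_real (d i)) ** mat_adj V \<and>
      Q = V ** diag_of (\<lambda>i. complex_of_real (d i powr s)) ** mat_adj V)"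

definition mat_modulus :: "complex^'n^'n \<Rightarrow> complex^'n^'n" where
  "mat_modulus T = mat_powr (mat_adj T ** T) (1/2)"

(* The factor U of the canonical polar decomposition T = U |T|: the unique partial
   isometry with this property that has the same kernel as T.  It is unitary when T
   is invertible. *)
definition polar_factor :: "complex^'n^'n \<Rightarrow> complex^'n^'n" where
  "polar_factor T = (THE U. T = U ** mat_modulus T \<and> U ** mat_adj U ** U = U \<and>
      (\<forall>v. U *v v = 0 \<longleftrightarrow> T *v v = 0))"

definition aluthge :: "real \<Rightarrow> complex^'n^'n \<Rightarrow> complex^'n^'n" where
  "aluthge l T = mat_powr (mat_modulus T) l ** polar_factor T ** mat_powr (mat_modulus T) (1 - l)"

definition aluthge_limit :: "real \<Rightarrow> complex^'n^'n \<Rightarrow> complex^'n^'n" where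
  "aluthge_limit l T = lim (\<lambda>n. (aluthge l ^^ n) T)"

lemma diag_of_mult_left: "(diag_of d ** A) $ i $ j = d i * (A $ i $ j :: 'a::comm_semiring_1)"
  by (simp add: diag_of_def matrix_matrix_mult_def if_distrib[of "\<lambda>x. x * _"] cong: if_cong)

lemma diag_of_mult_right: "(A ** diag_of d) $ i $ j = (A $ i $ j :: 'a::comm_semiring_1) * d j"
  by (simp add: diag_of_def matrix_matrix_mult_def if_distrib[of "\<lambda>x. _ * x"] cong: if_cong)

lemma mat_powr_unique:
  fixes V W :: "complex^'n^'n" and d e :: "'n \<Rightarrow> real"
  assumes V: "unitary_mat V" and W: "unitary_mat W"
    and eq: "V ** diag_of (\<lambda>i. complex_of_real (d i)) ** mat_adj V
           = W ** diag_of (\<lambda>i. complex_of_real (e i)) ** mat_adj W"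
  shows "V ** diag_of (\<lambda>i. complex_of_real (d i powr s)) ** mat_adj V
       = W ** diag_of (\<lambda>i. complex_of_real (e i powr s)) ** mat_adj W"
proof -
  define A where "A = mat_adj W ** V"
  have intertwine: "(V ** D ** mat_adj V = W ** E ** mat_adj W) = (A ** D = E ** A)" for D E
  proof
    assume h: "V ** D ** mat_adj V = W ** E ** mat_adj W"
    have "A ** D = mat_adj W ** (V ** D ** mat_adj V) ** V"
      using V by (simp add: A_def unitary_mat_def flip: matrix_mul_assoc)
    also have "\<dots> = (mat_adj W ** W) ** E ** (mat_adj W ** V)"
      by (simp only: h matrix_mul_assoc)
    also have "\<dots> = E ** A"
      using W by (simp add: A_def unitary_mat_def)
    finally show "A ** D = E ** A" .
  next
    assume h: "A ** D = E ** A"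
    have "V ** D ** mat_adj V = (W ** mat_adj W) ** V ** D ** mat_adj V"
      using W by (simp add: unitary_mat_def)
    also have "\<dots> = W ** (A ** D) ** mat_adj V"
      by (simp add: A_def matrix_mul_assoc)
    also have "\<dots> = W ** E ** mat_adj W ** (V ** mat_adj V)"
      by (simp add: h, simp add: A_def matrix_mul_assoc)
    also have "\<dots> = W ** E ** mat_adj W"
      using V by (simp add: unitary_mat_def)
    finally show "V ** D ** mat_adj V = W ** E ** mat_adj W" .
  qed
  have entries: "A $ i $ j * complex_of_real (d j) = complex_of_real (e i) * A $ i $ j" for i j
    using eq unfolding intertwine by (metis diag_of_mult_left diag_of_mult_right)
  have "A $ i $ j * complex_of_real (d j powr s) = complex_of_real (e i powr s) * A $ i $ j" for i j
    using entries[of i j] by (cases "A $ i $ j = 0") auto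
  then show ?thesis
    unfolding intertwine by (simp add: vec_eq_iff diag_of_mult_left diag_of_mult_right)
qed

lemma mat_powr_eq:
  fixes V :: "complex^'n^'n" and d :: "'n \<Rightarrow> real"
  assumes "unitary_mat V" "\<And>i. 0 \<le> d i"
    and "P = V ** diag_of (\<lambda>i. complex_of_real (d i)) ** mat_adj V"
  shows "mat_powr P s = V ** diag_of (\<lambda>i. complex_of_real (d i powr s)) ** mat_adj V"
  unfolding mat_powr_def
proof (rule the_equality)
  show "\<exists>V' (d' :: 'n \<Rightarrow> real). unitary_mat V' \<and> (\<forall>i. 0 \<le> d' i) \<and>
      P = V' ** diag_of (\<lambda>i. complex_of_real (d' i)) ** mat_adj V' \<and>
      V ** diag_of (\<lambda>i. complex_of_real (d i powr s)) ** mat_adj V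
        = V' ** diag_of (\<lambda>i. complex_of_real (d' i powr s)) ** mat_adj V'"
    using assms by blast
next
  fix Q
  assume "\<exists>V' (d' :: 'n \<Rightarrow> real). unitary_mat V' \<and> (\<forall>i. 0 \<le> d' i) \<and>
      P = V' ** diag_of (\<lambda>i. complex_of_real (d' i)) ** mat_adj V' \<and>
      Q = V' ** diag_of (\<lambda>i. complex_of_real (d' i powr s)) ** mat_adj V'"
  then obtain V' and d' :: "'n \<Rightarrow> real" where h: "unitary_mat V'"
      "P = V' ** diag_of (\<lambda>i. complex_of_real (d' i)) ** mat_adj V'"
      "Q = V' ** diag_of (\<lambda>i. complex_of_real (d' i powr s)) ** mat_adj V'"
    by blast
  show "Q = V ** diag_of (\<lambda>i. complex_of_real (d i powr s)) ** mat_adj V"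
    unfolding h(3) by (rule mat_powr_unique[OF h(1) assms(1)]) (use h(2) assms(3) in simp)
qed

end

theory Submission
  imports Defs
begin

text \<open>
  It suffices to vary a 2x2 block of the diagonal matrix carrying two eigenvalues a, b of different
  modulus. If every R_T were constant, the limit L for parameter 1/2 would be the limit for all
  parameters, so L(\<Delta>_l(T)) = L(T) for every l. In two dimensions \<Delta>_l(T) and \<Delta>_(1-l)(T) are
  unitarily equivalent by some unitary W_l, and L is equivariant under unitary conjugation; hence
  L(T) commutes with every W_l. For suitable T the W_l for two different l have only scalar matrices
  as common commutant, unless a and b have the same argument; in that case T is a complex multiple
  of a real matrix, hence so is L(T), and W_l is a real rotation, so that L(T) commuting with it
  forces a and b to have the same modulus. The only analytic input is the convergence of the
  iteration for parameter 1/2, where the excess |T|^2 - |a|^2 - |b|^2 of the squared Frobenius norm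
  decays geometrically and dominates the squared length of every step.
\<close>

section \<open>Unitary factors and the normal form\<close>

abbreviation rdiag :: "('n \<Rightarrow> real) \<Rightarrow> complex^'n^'n" where
  "rdiag f \<equiv> diag_of (\<lambda>i. complex_of_real (f i))"

lemma mat_adj_nth: "mat_adj A $ i $ j = cnj (A $ j $ i)"
  by (simp add: mat_adj_def transpose_def map_matrix_def)

lemma mat_adj_mult: "mat_adj (A ** B) = mat_adj B ** mat_adj A"
  by (simp add: vec_eq_iff mat_adj_nth matrix_matrix_mult_def mult.commute)

lemma mat_adj_adj [simp]: "mat_adj (mat_adj A) = A"
  by (simp add: vec_eq_iff mat_adj_nth)

lemma mat_adj_rdiag [simp]: "mat_adj (rdiag f) = rdiag f"
  by (simp add: vec_eq_iff mat_adj_nth diag_of_def)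

lemma rdiag_mult: "rdiag f ** rdiag g = rdiag (\<lambda>i. f i * g i)"
  unfolding vec_eq_iff diag_of_mult_left by (simp add: diag_of_def)

lemma rdiag_one: "rdiag (\<lambda>i. 1) = mat 1"
  by (simp add: vec_eq_iff diag_of_def mat_def)

lemma unitary_mat_mult: "unitary_mat V \<Longrightarrow> unitary_mat W \<Longrightarrow> unitary_mat (V ** W)"
  unfolding unitary_mat_def mat_adj_mult
  by (metis matrix_mul_assoc matrix_mul_lid)

lemma unitary_mat_adj: "unitary_mat V \<Longrightarrow> unitary_mat (mat_adj V)"
  unfolding unitary_mat_def by simp

lemma unitary_cancel:
  assumes "unitary_mat V"
  shows "mat_adj V ** V = mat 1" "V ** mat_adj V = mat 1"
    "mat_adj V ** (V ** B) = B" "V ** (mat_adj V ** B) = B"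
  using assms unfolding unitary_mat_def by (auto simp: matrix_mul_assoc)

lemma unitary_matI:
  fixes V :: "complex^'n^'n"
  assumes "mat_adj V ** V = mat 1"
  shows "unitary_mat V"
  using assms unfolding unitary_mat_def by (simp add: matrix_left_right_inverse)

text \<open>An invertible modulus can be cancelled on the right, which makes the factor unique.
  \<open>T\<close> and \<open>U\<close> are then both injective, so their kernels agree
  trivially.\<close>

lemma polar_factor_eq:
  fixes U M :: "complex^'n^'n"
  assumes U: "unitary_mat U" and M: "mat_modulus T = M" "M ** N = mat 1" and T: "T = U ** M"
  shows "polar_factor T = U"
  unfolding polar_factor_def
proof (rule the_equality)
  have N: "N ** M = mat 1"
    using M(2) by (simp add: matrix_left_right_inverse)
  have "T *v v = 0 \<longleftrightarrow> v = 0" for v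
  proof
    assume "T *v v = 0"
    then have "N ** mat_adj U ** U ** M *v v = 0"
      unfolding T by (simp add: matrix_vector_mul_assoc[symmetric])
    then show "v = 0"
      using N U by (simp add: unitary_cancel matrix_mul_assoc[symmetric])
  qed simp
  moreover have "U *v v = 0 \<longleftrightarrow> v = 0" for v
    by (metis U unitary_cancel(1) matrix_vector_mul_assoc matrix_vector_mul_lid matrix_vector_mult_0_right)
  ultimately show "T = U ** mat_modulus T \<and> U ** mat_adj U ** U = U \<and>
      (\<forall>v. U *v v = 0 \<longleftrightarrow> T *v v = 0)"
    using M T U by (simp add: unitary_cancel matrix_mul_assoc[symmetric])
next
  fix U' assume "T = U' ** mat_modulus T \<and> U' ** mat_adj U' ** U' = U' \<and>
      (\<forall>v. U' *v v = 0 \<longleftrightarrow> T *v v = 0)"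
  then have "U' ** M ** N = U ** M ** N"
    using M T by simp
  then show "U' = U"
    using M(2) by (simp add: matrix_mul_assoc[symmetric])
qed

text \<open>In the basis given by \<open>V\<close> the modulus is \<open>rdiag \<sigma>\<close> and
  the polar factor is \<open>X\<close>, so the transform only distributes \<open>\<sigma>\<close>
  over the two sides of \<open>X\<close>. All later computations use this formula in place of the
  definite descriptions behind \<open>mat_powr\<close> and \<open>polar_factor\<close>.\<close>

lemma aluthge_normal_form:
  fixes V X :: "complex^'n^'n" and \<sigma> :: "'n \<Rightarrow> real"
  assumes V: "unitary_mat V" and X: "unitary_mat X" and \<sigma>: "\<And>i. 0 < \<sigma> i"
  shows "aluthge l (V ** X ** rdiag \<sigma> ** mat_adj V)
       = V ** rdiag (\<lambda>i. \<sigma> i powr l) ** X ** rdiag (\<lambda>i. \<sigma> i powr (1 - l)) ** mat_adj V"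
proof -
  define T where "T = V ** X ** rdiag \<sigma> ** mat_adj V"
  define M where "M = V ** rdiag \<sigma> ** mat_adj V"
  note assoc = matrix_mul_assoc[symmetric]
  have \<sigma>': "\<sigma> i \<noteq> 0" for i
    using \<sigma>[of i] by simp
  have "mat_adj T ** T = V ** (rdiag \<sigma> ** rdiag \<sigma>) ** mat_adj V"
    using V X by (simp add: T_def mat_adj_mult assoc unitary_cancel)
  then have TT: "mat_adj T ** T = V ** rdiag (\<lambda>i. \<sigma> i * \<sigma> i) ** mat_adj V"
    by (simp add: rdiag_mult)
  have "(\<sigma> i * \<sigma> i) powr (1/2) = \<sigma> i" for i
    using \<sigma>[of i] by (simp add: powr_half_sqrt)
  then have mod: "mat_modulus T = M"
    unfolding mat_modulus_def M_def
    by (subst mat_powr_eq[OF V _ TT]) auto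
  have pw: "mat_powr M s = V ** rdiag (\<lambda>i. \<sigma> i powr s) ** mat_adj V" for s
    by (rule mat_powr_eq[OF V _ M_def]) (simp add: \<sigma> less_imp_le)
  have inv: "M ** (V ** rdiag (\<lambda>i. inverse (\<sigma> i)) ** mat_adj V) = mat 1"
  proof -
    have "rdiag \<sigma> ** rdiag (\<lambda>i. inverse (\<sigma> i)) = mat 1"
      unfolding rdiag_mult using \<sigma>' by (simp flip: rdiag_one)
    then have "rdiag \<sigma> ** (rdiag (\<lambda>i. inverse (\<sigma> i)) ** Z) = Z" for Z :: "complex^'n^'n"
      by (simp add: matrix_mul_assoc)
    then show ?thesis
      using V by (simp add: M_def assoc unitary_cancel)
  qed
  have U: "unitary_mat (V ** X ** mat_adj V)"
    using V X by (intro unitary_mat_mult unitary_mat_adj)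
  have "polar_factor T = V ** X ** mat_adj V"
    by (rule polar_factor_eq[OF U mod inv]) (use V in \<open>simp add: T_def M_def assoc unitary_cancel\<close>)
  then have "aluthge l T = V ** rdiag (\<lambda>i. \<sigma> i powr l) ** X ** rdiag (\<lambda>i. \<sigma> i powr (1 - l)) ** mat_adj V"
    unfolding aluthge_def mod pw using V by (simp add: assoc unitary_cancel)
  then show ?thesis unfolding T_def .
qed

section \<open>Embedding a 2x2 block\<close>

text \<open>Taking the surrounding diagonal \<open>d\<close> as a function on the whole index type
  lets products and adjoints act on it pointwise, separately from the block.\<close>

definition embed2 :: "'n \<Rightarrow> 'n \<Rightarrow> ('n \<Rightarrow> complex) \<Rightarrow> complex^2^2 \<Rightarrow> complex^'n^'n" where
  "embed2 i j d A = (\<chi> k l. if k \<in> {i, j} \<and> l \<in> {i, j}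
      then A $ (if k = i then 1 else 2) $ (if l = i then 1 else 2)
      else if k = l then d k else 0)"

lemma embed2_mult:
  assumes "i \<noteq> j"
  shows "embed2 i j d A ** embed2 i j e B = embed2 i j (\<lambda>k. d k * e k) (A ** B)"
proof -
  have "(\<Sum>m\<in>UNIV. embed2 i j d A $ k $ m * embed2 i j e B $ m $ l)
      = embed2 i j (\<lambda>k. d k * e k) (A ** B) $ k $ l" for k l
  proof (cases "k \<in> {i, j}")
    case True
    have "(\<Sum>m\<in>UNIV. embed2 i j d A $ k $ m * embed2 i j e B $ m $ l)
        = (\<Sum>m\<in>{i, j}. embed2 i j d A $ k $ m * embed2 i j e B $ m $ l)"
      using True by (intro sum.mono_neutral_right) (auto simp: embed2_def)
    then show ?thesis
      using True assms by (auto simp: embed2_def matrix_matrix_mult_def sum_2)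
  next
    case False
    have "(\<Sum>m\<in>UNIV. embed2 i j d A $ k $ m * embed2 i j e B $ m $ l)
        = (\<Sum>m\<in>{k}. embed2 i j d A $ k $ m * embed2 i j e B $ m $ l)"
      using False by (intro sum.mono_neutral_right) (auto simp: embed2_def)
    then show ?thesis
      using False by (auto simp: embed2_def)
  qed
  then show ?thesis
    by (simp add: vec_eq_iff matrix_matrix_mult_def[of "embed2 i j d A"])
qed

lemma embed2_adj: "mat_adj (embed2 i j d A) = embed2 i j (\<lambda>k. cnj (d k)) (mat_adj A)"
  by (auto simp: vec_eq_iff mat_adj_nth embed2_def)

lemma embed2_rdiag:
  assumes "i \<noteq> j"
  shows "embed2 i j (\<lambda>k. complex_of_real (d k)) (rdiag \<sigma>) = rdiag (\<lambda>k. if k = i then \<sigma> 1 else if k = j then \<sigma> 2 else d k)"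
  using assms by (auto simp: vec_eq_iff embed2_def diag_of_def)

lemma embed2_one: "i \<noteq> j \<Longrightarrow> embed2 i j (\<lambda>k. 1) (mat 1) = mat 1"
  by (auto simp: vec_eq_iff embed2_def mat_def)

lemma embed2_unitary:
  assumes "i \<noteq> j" "unitary_mat V" "\<And>k. cmod (d k) = 1"
  shows "unitary_mat (embed2 i j d V)"
proof (rule unitary_matI)
  have "cnj (d k) * d k = 1" for k
    using assms(3)[of k] by (simp add: mult.commute[of "cnj _"] complex_norm_square[symmetric])
  then show "mat_adj (embed2 i j d V) ** embed2 i j d V = mat 1"
    using assms by (simp add: embed2_adj embed2_mult unitary_cancel embed2_one)
qed

lemma embed2_nth:
  assumes "i \<noteq> j"
  shows "embed2 i j d A $ i $ i = A $ 1 $ 1" "embed2 i j d A $ i $ j = A $ 1 $ 2"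
    "embed2 i j d A $ j $ i = A $ 2 $ 1" "embed2 i j d A $ j $ j = A $ 2 $ 2"
  using assms by (simp_all add: embed2_def)

lemma embed2_inject:
  assumes "i \<noteq> j" "embed2 i j d A = embed2 i j d B"
  shows "A = B"
  using embed2_nth[OF assms(1), of d A] embed2_nth[OF assms(1), of d B] assms(2)
  by (simp add: vec_eq_iff forall_2)

lemma tendsto_embed2:
  assumes "(f \<longlongrightarrow> A) F"
  shows "((\<lambda>n. embed2 i j d (f n)) \<longlongrightarrow> embed2 i j d A) F"
proof (intro vec_tendstoI)
  fix k l
  show "((\<lambda>n. embed2 i j d (f n) $ k $ l) \<longlongrightarrow> embed2 i j d A $ k $ l) F"
    using assms by (cases "k \<in> {i, j} \<and> l \<in> {i, j}")
      (auto simp: embed2_def intro: tendsto_vec_nth tendsto_const)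
qed

section \<open>Two-by-two matrices\<close>

lemma cnj_mult_self: "cnj z * z = complex_of_real ((cmod z)\<^sup>2)" "z * cnj z = complex_of_real ((cmod z)\<^sup>2)"
  by (simp_all only: complex_norm_square mult.commute[of "cnj z"])

definition mat2 :: "complex \<Rightarrow> complex \<Rightarrow> complex \<Rightarrow> complex \<Rightarrow> complex^2^2" where
  "mat2 p q r s = vector [vector [p, q], vector [r, s]]"

lemma mat2_nth [simp]:
  "mat2 p q r s $ 1 $ 1 = p" "mat2 p q r s $ 1 $ 2 = q"
  "mat2 p q r s $ 2 $ 1 = r" "mat2 p q r s $ 2 $ 2 = s"
  by (simp_all add: mat2_def)

lemma matrix2_eq_iff:
  fixes A B :: "'a^2^2"
  shows "A = B \<longleftrightarrow> A$1$1 = B$1$1 \<and> A$1$2 = B$1$2 \<and> A$2$1 = B$2$1 \<and> A$2$2 = B$2$2"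
  by (auto simp: vec_eq_iff forall_2)

lemma mult2_nth:
  fixes A B :: "complex^2^2"
  shows "(A ** B) $ i $ j = A $ i $ 1 * B $ 1 $ j + A $ i $ 2 * B $ 2 $ j"
  by (simp add: matrix_matrix_mult_def sum_2)

lemma trace_2: "trace (A :: complex^2^2) = A$1$1 + A$2$2"
  by (simp add: trace_def sum_2)

lemma mat_2_nth [simp]:
  "(mat z :: complex^2^2) $ 1 $ 1 = z" "(mat z :: complex^2^2) $ 1 $ 2 = 0"
  "(mat z :: complex^2^2) $ 2 $ 1 = 0" "(mat z :: complex^2^2) $ 2 $ 2 = z"
  by (simp_all add: mat_def)

text \<open>The second row must be a unit vector orthogonal to the first, which leaves only the
  choice of a phase \<open>w\<close>; it is the determinant.\<close>

lemma unitary_2_iff: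
  fixes X :: "complex^2^2"
  shows "unitary_mat X \<longleftrightarrow> (\<exists>x y w. cmod w = 1 \<and> (cmod x)\<^sup>2 + (cmod y)\<^sup>2 = 1 \<and>
    X = mat2 x y (- w * cnj y) (w * cnj x))"
proof
  assume "unitary_mat X"
  define x y r s where "x = X$1$1" "y = X$1$2" "r = X$2$1" "s = X$2$2"
  define w where "w = x * s - y * r"
  from \<open>unitary_mat X\<close> have "X ** mat_adj X = mat 1"
    by (simp add: unitary_mat_def)
  then have eqs: "x * cnj x + y * cnj y = 1" "x * cnj r + y * cnj s = 0"
      "r * cnj x + s * cnj y = 0" "r * cnj r + s * cnj s = 1"
    by (simp_all add: matrix2_eq_iff mult2_nth mat_adj_nth x_y_r_s_def)
  have s: "s = w * cnj x" and r: "r = - w * cnj y"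
    using eqs unfolding w_def by algebra+
  have one: "(cmod x)\<^sup>2 + (cmod y)\<^sup>2 = 1"
    using eqs(1) unfolding cnj_mult_self by (metis of_real_add of_real_eq_1_iff)
  have "(cmod r)\<^sup>2 + (cmod s)\<^sup>2 = 1"
    using eqs(4) unfolding cnj_mult_self by (metis of_real_add of_real_eq_1_iff)
  then have "(cmod w)\<^sup>2 * ((cmod x)\<^sup>2 + (cmod y)\<^sup>2) = 1"
    unfolding r s by (simp add: norm_mult power_mult_distrib algebra_simps)
  then have "cmod w = 1"
    unfolding one using norm_ge_zero[of w] by (auto simp: power2_eq_1_iff)
  moreover have "X = mat2 x y (- w * cnj y) (w * cnj x)"
    unfolding matrix2_eq_iff using r s by (simp add: x_y_r_s_def)
  ultimately show "\<exists>x y w. cmod w = 1 \<and> (cmod x)\<^sup>2 + (cmod y)\<^sup>2 = 1 \<and>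
    X = mat2 x y (- w * cnj y) (w * cnj x)"
    using one by blast
next
  assume "\<exists>x y w. cmod w = 1 \<and> (cmod x)\<^sup>2 + (cmod y)\<^sup>2 = 1 \<and>
    X = mat2 x y (- w * cnj y) (w * cnj x)"
  then obtain x y w where w: "cmod w = 1" and one: "(cmod x)\<^sup>2 + (cmod y)\<^sup>2 = 1"
    and X: "X = mat2 x y (- w * cnj y) (w * cnj x)" by blast
  have "cnj w * w = 1"
    using w by (simp add: cnj_mult_self)
  moreover have "cnj x * x + cnj y * y = 1"
    using one unfolding cnj_mult_self of_real_add[symmetric] by simp
  ultimately have "mat_adj X ** X = mat 1"
    unfolding X matrix2_eq_iff mult2_nth mat_adj_nth by simp algebra
  then show "unitary_mat X" by (rule unitary_matI)
qed

lemma hermitian_2_diagonalize: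
  fixes P :: "complex^2^2"
  assumes "mat_adj P = P"
  obtains V where "unitary_mat V" "(mat_adj V ** P ** V) $ 1 $ 2 = 0" "(mat_adj V ** P ** V) $ 2 $ 1 = 0"
proof -
  define q where "q = P$1$2"
  have herm: "cnj (P$1$1) = P$1$1" "cnj (P$2$2) = P$2$2" "P$2$1 = cnj q"
    using assms by (simp_all add: matrix2_eq_iff mat_adj_nth q_def)
  then obtain p r where pr: "P$1$1 = complex_of_real p" "P$2$2 = complex_of_real r"
    by (metis Reals_cases Reals_cnj_iff)
  show thesis
  proof (cases "q = 0")
    case True
    then show thesis
      using herm by (intro that[of "mat 1"]) (simp_all add: unitary_mat_def q_def mat_adj_nth matrix2_eq_iff mult2_nth)
  next
    case False
    define R where "R = sqrt (((r - p) / 2)\<^sup>2 + (cmod q)\<^sup>2)"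
    \<comment> \<open>The larger root of the equation \<open>m\<close> below, which says that the
      vector (q, m) is an eigenvector of \<open>P\<close> for the eigenvalue p + m. The columns of
      \<open>V\<close> are this vector and an orthogonal one, normalised by
      \<open>\<nu>\<close>.\<close>
    define m where "m = (r - p) / 2 + R"
    define \<nu> where "\<nu> = sqrt ((cmod q)\<^sup>2 + m\<^sup>2)"
    have "R\<^sup>2 = ((r - p) / 2)\<^sup>2 + (cmod q)\<^sup>2"
      by (simp add: R_def)
    moreover have "m\<^sup>2 + (p - r) * m = R\<^sup>2 - ((r - p) / 2)\<^sup>2"
      by (simp add: m_def power2_eq_square field_simps)
    ultimately have m: "m\<^sup>2 + (p - r) * m - (cmod q)\<^sup>2 = 0"
      by simp
    have \<nu>: "\<nu>\<^sup>2 = (cmod q)\<^sup>2 + m\<^sup>2" "0 < \<nu>"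
      using False by (simp_all add: \<nu>_def add_pos_nonneg)
    have mc: "of_real m * of_real m + (of_real p - of_real r) * of_real m - cnj q * q = (0::complex)"
      using arg_cong[OF m, of complex_of_real] unfolding cnj_mult_self by (simp add: power2_eq_square)
    define V where "V = mat2 (q / \<nu>) (- of_real m / \<nu>) (of_real m / \<nu>) (cnj q / \<nu>)"
    have "(cmod (q / \<nu>))\<^sup>2 + (cmod (- of_real m / \<nu>))\<^sup>2 = 1"
      using \<nu> False by (simp add: norm_divide power_divide add_divide_distrib[symmetric])
    moreover have "V = mat2 (q / \<nu>) (- of_real m / \<nu>) (- 1 * cnj (- of_real m / \<nu>)) (1 * cnj (q / \<nu>))"
      by (simp add: V_def)
    ultimately have V: "unitary_mat V"
      unfolding unitary_2_iff by (metis norm_one)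
    have "\<nu> \<noteq> 0" using \<nu> by simp
    then have "(mat_adj V ** P ** V) $ 1 $ 2 * of_real (\<nu>\<^sup>2)
      = - cnj q * (of_real m * of_real m + (of_real p - of_real r) * of_real m - cnj q * q)"
      "(mat_adj V ** P ** V) $ 2 $ 1 * of_real (\<nu>\<^sup>2)
      = - q * (of_real m * of_real m + (of_real p - of_real r) * of_real m - cnj q * q)"
      using herm pr by (simp_all add: mult2_nth mat_adj_nth V_def q_def[symmetric] field_simps power2_eq_square)
    then have "(mat_adj V ** P ** V) $ 1 $ 2 = 0" "(mat_adj V ** P ** V) $ 2 $ 1 = 0"
      unfolding mc using \<open>\<nu> \<noteq> 0\<close> by (simp_all del: of_real_power)
    with V show thesis by (rule that)
  qed
qed

text \<open>A singular value decomposition. If \<open>V\<close> diagonalises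
  \<open>mat_adj T ** T\<close>, the columns of \<open>T ** V\<close> are orthogonal; their lengths
  \<open>\<sigma>\<close> are positive because \<open>T\<close> is invertible. Rescaling the columns
  to unit length and multiplying by \<open>mat_adj V\<close> from the left gives
  \<open>X\<close>.\<close>

lemma normal_form_2:
  fixes T :: "complex^2^2"
  assumes "det T \<noteq> 0"
  obtains V X :: "complex^2^2" and \<sigma> :: "2 \<Rightarrow> real"
  where "unitary_mat V" "unitary_mat X" "\<And>i. 0 < \<sigma> i" "T = V ** X ** rdiag \<sigma> ** mat_adj V"
proof -
  note assoc = matrix_mul_assoc[symmetric]
  have "mat_adj (mat_adj T ** T) = mat_adj T ** T"
    by (simp add: mat_adj_mult)
  then obtain V where V: "unitary_mat V" and off:
      "(mat_adj V ** (mat_adj T ** T) ** V) $ 1 $ 2 = 0" "(mat_adj V ** (mat_adj T ** T) ** V) $ 2 $ 1 = 0"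
    by (rule hermitian_2_diagonalize)
  define Y where "Y = T ** V"
  define d where "d i = (cmod (Y$1$i))\<^sup>2 + (cmod (Y$2$i))\<^sup>2" for i
  have YY: "mat_adj V ** (mat_adj T ** T) ** V = mat_adj Y ** Y"
    by (simp add: Y_def mat_adj_mult assoc)
  have "mat_adj Y ** Y = rdiag d"
    using off unfolding YY by (simp add: matrix2_eq_iff mult2_nth mat_adj_nth diag_of_def d_def cnj_mult_self)
  have "det V \<noteq> 0"
    using V by (metis unitary_cancel(1) det_mul det_I mult_zero_right zero_neq_one)
  then have "det Y \<noteq> 0"
    using assms by (simp add: Y_def det_mul)
  have d: "0 < d i" for i
  proof -
    have "\<not> (Y$1$i = 0 \<and> Y$2$i = 0)"
      using \<open>det Y \<noteq> 0\<close> exhaust_2[of i] by (auto simp: det_2)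
    then show ?thesis
      by (auto simp: d_def add_pos_nonneg add_nonneg_pos)
  qed
  define \<sigma> where "\<sigma> i = sqrt (d i)" for i
  have \<sigma>: "0 < \<sigma> i" "\<sigma> i * \<sigma> i = d i" "\<sigma> i \<noteq> 0" for i
    using d[of i] by (simp_all add: \<sigma>_def less_imp_le)
  define \<tau> where "\<tau> i = inverse (\<sigma> i)" for i
  have \<tau>: "\<tau> i * \<sigma> i = 1" "\<tau> i * (\<sigma> i * \<sigma> i) * \<tau> i = 1" for i
    using \<sigma>(3)[of i] by (simp_all add: \<tau>_def field_simps)
  define X where "X = mat_adj V ** Y ** rdiag \<tau>"
  have "mat_adj X ** X = rdiag \<tau> ** (mat_adj Y ** Y) ** rdiag \<tau>"
    using V by (simp add: X_def mat_adj_mult assoc unitary_cancel)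
  also have "\<dots> = mat 1"
    unfolding \<open>mat_adj Y ** Y = rdiag d\<close> rdiag_mult \<sigma>(2)[symmetric] \<tau>(2) by (rule rdiag_one)
  finally have X: "unitary_mat X"
    by (rule unitary_matI)
  have "rdiag \<tau> ** rdiag \<sigma> = mat 1"
    unfolding rdiag_mult \<tau>(1) by (rule rdiag_one)
  then have "X ** rdiag \<sigma> = mat_adj V ** Y"
    by (simp add: X_def assoc)
  then have "T = V ** X ** rdiag \<sigma> ** mat_adj V"
    using V by (simp add: assoc) (simp add: Y_def matrix_mul_assoc unitary_cancel, simp add: assoc unitary_cancel)
  with V X \<sigma>(1) show thesis by (rule that)
qed

section \<open>Symmetries and invariants of the Aluthge transform\<close>

lemma mat_mult_commute: "mat z ** A = A ** mat z" for A :: "complex^2^2"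
  by (simp add: matrix2_eq_iff mult2_nth mult.commute)

lemma map_matrix_mult_cnj: "map_matrix cnj (A ** B) = map_matrix cnj A ** map_matrix cnj B"
  by (simp add: vec_eq_iff map_matrix_def matrix_matrix_mult_def)

lemma map_matrix_cnj_adj: "map_matrix cnj (mat_adj A) = mat_adj (map_matrix cnj A)"
  by (simp add: vec_eq_iff map_matrix_def mat_adj_nth)

lemma map_matrix_cnj_rdiag: "map_matrix cnj (rdiag f) = rdiag f"
  by (simp add: vec_eq_iff map_matrix_def diag_of_def)

lemma map_matrix_cnj_one: "map_matrix cnj (mat 1) = mat 1"
  by (simp add: vec_eq_iff map_matrix_def mat_def)

lemma unitary_mat_cnj: "unitary_mat V \<Longrightarrow> unitary_mat (map_matrix cnj V)"
  by (metis unitary_mat_def map_matrix_mult_cnj map_matrix_cnj_adj map_matrix_cnj_one)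

lemma unitary_mat_scalar: "cmod z = 1 \<Longrightarrow> unitary_mat (mat z :: complex^2^2)"
  by (rule unitary_matI) (simp add: matrix2_eq_iff mult2_nth mat_adj_nth cnj_mult_self)

text \<open>Conjugation replaces \<open>V\<close> by \<open>W ** V\<close> in the normal form and
  leaves \<open>X\<close> and \<open>\<sigma>\<close> alone.\<close>

lemma aluthge_unitary_conj:
  fixes T W :: "complex^2^2"
  assumes "det T \<noteq> 0" and W: "unitary_mat W"
  shows "aluthge l (W ** T ** mat_adj W) = W ** aluthge l T ** mat_adj W"
proof -
  obtain V X :: "complex^2^2" and \<sigma> :: "2 \<Rightarrow> real" where V: "unitary_mat V" and X: "unitary_mat X"
    and \<sigma>: "\<And>i. 0 < \<sigma> i" and T: "T = V ** X ** rdiag \<sigma> ** mat_adj V"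
    using normal_form_2[OF assms(1)] by blast
  have "W ** T ** mat_adj W = (W ** V) ** X ** rdiag \<sigma> ** mat_adj (W ** V)"
    by (simp add: T mat_adj_mult matrix_mul_assoc)
  then show ?thesis
    by (simp only: aluthge_normal_form[OF unitary_mat_mult[OF W V] X \<sigma>])
      (simp only: T aluthge_normal_form[OF V X \<sigma>] mat_adj_mult matrix_mul_assoc)
qed

text \<open>In the normal form \<open>V\<close> becomes its conjugate and \<open>X\<close> becomes z
  times its conjugate, while \<open>\<sigma>\<close> is real and stays. If z is the square of a unit
  number g, the matrices fixed by this operation are those of the form g times a real matrix, and
  the transform preserves them.\<close>

lemma aluthge_cnj:
  fixes T :: "complex^2^2"
  assumes "det T \<noteq> 0" and z: "cmod z = 1"
  shows "aluthge l (mat z ** map_matrix cnj T) = mat z ** map_matrix cnj (aluthge l T)"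
proof -
  obtain V X :: "complex^2^2" and \<sigma> :: "2 \<Rightarrow> real" where V: "unitary_mat V" and X: "unitary_mat X"
    and \<sigma>: "\<And>i. 0 < \<sigma> i" and T: "T = V ** X ** rdiag \<sigma> ** mat_adj V"
    using normal_form_2[OF assms(1)] by blast
  have step: "aluthge l T = V ** rdiag (\<lambda>i. \<sigma> i powr l) ** X ** rdiag (\<lambda>i. \<sigma> i powr (1 - l)) ** mat_adj V"
    unfolding T aluthge_normal_form[OF V X \<sigma>] ..
  have swap: "mat z ** (A ** B) = A ** (mat z ** B)" for A B :: "complex^2^2"
    by (metis mat_mult_commute matrix_mul_assoc)
  note V' = unitary_mat_cnj[OF V]
  note X' = unitary_mat_mult[OF unitary_mat_scalar[OF z] unitary_mat_cnj[OF X]]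
  have "mat z ** map_matrix cnj T = map_matrix cnj V ** (mat z ** map_matrix cnj X) ** rdiag \<sigma>
      ** mat_adj (map_matrix cnj V)"
    by (simp add: T map_matrix_mult_cnj map_matrix_cnj_adj map_matrix_cnj_rdiag swap
      matrix_mul_assoc[symmetric])
  then show ?thesis
    by (simp only: aluthge_normal_form[OF V' X' \<sigma>])
      (simp only: step map_matrix_mult_cnj map_matrix_cnj_adj
        map_matrix_cnj_rdiag swap matrix_mul_assoc[symmetric])
qed

text \<open>Up to unitary conjugation the transform is \<open>A ** X ** B\<close> and
  \<open>T\<close> is \<open>X ** B ** A\<close>; determinant and trace do not see the cyclic
  shift.\<close>

lemma aluthge_det_trace:
  fixes T :: "complex^2^2"
  assumes "det T \<noteq> 0"
  shows "det (aluthge l T) = det T" "trace (aluthge l T) = trace T"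
proof -
  obtain V X :: "complex^2^2" and \<sigma> :: "2 \<Rightarrow> real" where V: "unitary_mat V" and X: "unitary_mat X"
    and \<sigma>: "\<And>i. 0 < \<sigma> i" and T: "T = V ** X ** rdiag \<sigma> ** mat_adj V"
    using normal_form_2[OF assms(1)] by blast
  define A B where "A = rdiag (\<lambda>i. \<sigma> i powr l)" and "B = rdiag (\<lambda>i. \<sigma> i powr (1 - l))"
  have AB: "B ** A = rdiag \<sigma>"
    using \<sigma> by (simp add: A_def B_def rdiag_mult powr_add[symmetric] less_imp_le)
  have eq: "aluthge l T = V ** A ** X ** B ** mat_adj V"
    unfolding T aluthge_normal_form[OF V X \<sigma>] A_def B_def ..
  show "det (aluthge l T) = det T"
    unfolding eq by (simp add: T det_mul AB[symmetric])
  have "trace (aluthge l T) = trace (mat_adj V ** (V ** A ** X ** B))"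
    unfolding eq by (rule trace_mul_sym)
  also have "\<dots> = trace (A ** (X ** B))"
    using V by (simp add: matrix_mul_assoc[symmetric] unitary_cancel)
  also have "\<dots> = trace (X ** B ** A)"
    by (rule trace_mul_sym)
  also have "\<dots> = trace (mat_adj V ** (V ** (X ** rdiag \<sigma>)))"
    using V by (simp add: matrix_mul_assoc[symmetric] unitary_cancel AB)
  also have "\<dots> = trace T"
    unfolding T by (subst trace_mul_sym) (simp add: matrix_mul_assoc)
  finally show "trace (aluthge l T) = trace T" .
qed

text \<open>Outside the block, each \<open>d k\<close> enters the normal form as a phase
  \<open>e k\<close> and a singular value \<open>cmod (d k)\<close>. The powers with exponents
  \<open>l\<close> and \<open>1 - l\<close> recombine to \<open>d k\<close>, so these entries are
  fixed.\<close>

lemma aluthge_embed2: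
  fixes T :: "complex^2^2"
  assumes "i \<noteq> j" "det T \<noteq> 0" and d: "\<And>k. d k \<noteq> 0"
  shows "aluthge l (embed2 i j d T) = embed2 i j d (aluthge l T)"
proof -
  obtain V X :: "complex^2^2" and \<sigma> :: "2 \<Rightarrow> real" where V: "unitary_mat V" and X: "unitary_mat X"
    and \<sigma>: "\<And>i. 0 < \<sigma> i" and T: "T = V ** X ** rdiag \<sigma> ** mat_adj V"
    using normal_form_2[OF assms(2)] by blast
  note [simp] = embed2_mult[OF \<open>i \<noteq> j\<close>]
  define \<sigma>' where "\<sigma>' k = (if k = i then \<sigma> 1 else if k = j then \<sigma> 2 else cmod (d k))" for k
  define e where "e k = d k / cmod (d k)" for k
  let ?V = "embed2 i j (\<lambda>k. 1) V" and ?X = "embed2 i j e X"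
  have V': "unitary_mat ?V" and X': "unitary_mat ?X"
    using V X d by (intro embed2_unitary \<open>i \<noteq> j\<close>; simp add: e_def norm_divide)+
  have \<sigma>': "0 < \<sigma>' k" for k
    using \<sigma> d by (simp add: \<sigma>'_def)
  have rdiag': "rdiag (\<lambda>k. \<sigma>' k powr s) = embed2 i j (\<lambda>k. complex_of_real (cmod (d k) powr s)) (rdiag (\<lambda>k. \<sigma> k powr s))" for s
    unfolding embed2_rdiag[OF \<open>i \<noteq> j\<close>] by (rule arg_cong[where f = diag_of]) (auto simp: \<sigma>'_def)
  have adj: "mat_adj ?V = embed2 i j (\<lambda>k. 1) (mat_adj V)"
    by (simp add: embed2_adj)
  have de: "e k * complex_of_real (cmod (d k)) = d k" for k
    using d by (simp add: e_def)
  have dl: "complex_of_real (cmod (d k) powr l) * e k * complex_of_real (cmod (d k) powr (1 - l)) = d k" for k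
  proof -
    have "cmod (d k) powr l * cmod (d k) powr (1 - l) = cmod (d k)"
      using d[of k] by (simp add: powr_add[symmetric])
    then show ?thesis
      by (metis de mult.assoc mult.commute of_real_mult)
  qed
  \<comment> \<open>The exponent 1 in \<open>rdiag'\<close> yields \<open>rdiag \<sigma>'\<close>
    itself.\<close>
  have "embed2 i j d T = ?V ** ?X ** rdiag \<sigma>' ** mat_adj ?V"
    using rdiag'[of 1] \<sigma> \<sigma>' d unfolding T adj by (simp add: de less_imp_le)
  then have "aluthge l (embed2 i j d T) = ?V ** rdiag (\<lambda>k. \<sigma>' k powr l) ** ?X ** rdiag (\<lambda>k. \<sigma>' k powr (1 - l)) ** mat_adj ?V"
    by (simp only: aluthge_normal_form[OF V' X' \<sigma>'])
  also have "\<dots> = embed2 i j d (V ** rdiag (\<lambda>i. \<sigma> i powr l) ** X ** rdiag (\<lambda>i. \<sigma> i powr (1 - l)) ** mat_adj V)"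
    unfolding rdiag' adj by (simp add: dl)
  finally show ?thesis
    unfolding T aluthge_normal_form[OF V X \<sigma>] .
qed

section \<open>Convergence for the parameter 1/2\<close>

lemma norm_2_sq:
  fixes A :: "complex^2^2"
  shows "(norm A)\<^sup>2 = (cmod (A$1$1))\<^sup>2 + (cmod (A$1$2))\<^sup>2 + (cmod (A$2$1))\<^sup>2 + (cmod (A$2$2))\<^sup>2"
  by (simp add: norm_vec_def L2_set_def sum_2)

lemma norm_sq_trace:
  fixes A :: "complex^2^2"
  shows "complex_of_real ((norm A)\<^sup>2) = trace (mat_adj A ** A)"
  unfolding norm_2_sq trace_2 mult2_nth mat_adj_nth cnj_mult_self by simp

lemma norm_unitary_conj:
  fixes A V :: "complex^2^2"
  assumes "unitary_mat V"
  shows "norm (V ** A ** mat_adj V) = norm A"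
proof -
  have "trace (mat_adj (V ** A ** mat_adj V) ** (V ** A ** mat_adj V)) = trace (V ** (mat_adj A ** A ** mat_adj V))"
    using assms by (simp add: mat_adj_mult matrix_mul_assoc[symmetric] unitary_cancel)
  also have "\<dots> = trace (mat_adj A ** A)"
    using assms by (subst trace_mul_sym) (simp add: matrix_mul_assoc[symmetric] unitary_cancel)
  finally have "(norm (V ** A ** mat_adj V))\<^sup>2 = (norm A)\<^sup>2"
    unfolding norm_sq_trace[symmetric] of_real_eq_iff .
  then show ?thesis by simp
qed

text \<open>Up to unitary conjugation, \<open>T\<close> is a unitary matrix times diag(s, t), and
  the transform replaces the off-diagonal weights t and s by their geometric mean \<open>u\<close>,
  keeping the diagonal. The drop of the squared norm is therefore explicit, and it bounds the
  squared length of the step.\<close>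

lemma aluthge_half_2:
  fixes T :: "complex^2^2"
  assumes "det T \<noteq> 0"
  obtains s t x w where "0 < s" "0 < t" "cmod w = 1" "cmod x \<le> 1"
    "trace T = of_real s * x + of_real t * (w * cnj x)" "det T = of_real (s * t) * w"
    "(norm T)\<^sup>2 = s\<^sup>2 + t\<^sup>2"
    "(norm (aluthge (1/2) T))\<^sup>2 = (norm T)\<^sup>2 - (1 - (cmod x)\<^sup>2) * (s - t)\<^sup>2"
    "(norm (aluthge (1/2) T - T))\<^sup>2 \<le> (1 - (cmod x)\<^sup>2) * (s - t)\<^sup>2"
proof -
  obtain V X :: "complex^2^2" and \<sigma> :: "2 \<Rightarrow> real" where V: "unitary_mat V" and X: "unitary_mat X"
    and \<sigma>: "\<And>i. 0 < \<sigma> i" and T: "T = V ** X ** rdiag \<sigma> ** mat_adj V"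
    using normal_form_2[OF assms(1)] by blast
  obtain x y w where w: "cmod w = 1" and xy: "(cmod x)\<^sup>2 + (cmod y)\<^sup>2 = 1"
    and Xeq: "X = mat2 x y (- w * cnj y) (w * cnj x)"
    using X unfolding unitary_2_iff by blast
  define s t u where "s = \<sigma> 1" and "t = \<sigma> 2" and "u = sqrt s * sqrt t"
  have st: "0 < s" "0 < t"
    using \<sigma> by (simp_all add: s_def t_def)
  have u: "u\<^sup>2 = s * t" "0 < u" "2 * u \<le> s + t"
    using st arith_geo_mean_sqrt[of s t] by (simp_all add: u_def power_mult_distrib real_sqrt_mult)
  define A where "A = mat2 (s * x) (t * y) (- s * w * cnj y) (t * w * cnj x)"
  define A' where "A' = mat2 (s * x) (u * y) (- u * w * cnj y) (t * w * cnj x)"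
  have "X ** rdiag \<sigma> = A"
    by (simp add: matrix2_eq_iff diag_of_mult_right A_def Xeq s_def t_def)
  then have TA: "T = V ** A ** mat_adj V"
    unfolding T by (simp add: matrix_mul_assoc[symmetric])
  have "rdiag (\<lambda>i. \<sigma> i powr (1/2)) ** X ** rdiag (\<lambda>i. \<sigma> i powr (1 - 1/2)) = A'"
    using st by (simp add: matrix2_eq_iff diag_of_mult_right diag_of_mult_left A'_def Xeq
      s_def[symmetric] t_def[symmetric] powr_half_sqrt u_def mult_ac flip: of_real_mult)
  then have TA': "aluthge (1/2) T = V ** A' ** mat_adj V"
    unfolding T aluthge_normal_form[OF V X \<sigma>] by (simp only: matrix_mul_assoc[symmetric])
  have diff: "aluthge (1/2) T - T = V ** (A' - A) ** mat_adj V"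
    unfolding TA' by (subst TA) (simp add: matrix2_eq_iff mult2_nth algebra_simps)
  have y: "(cmod y)\<^sup>2 = 1 - (cmod x)\<^sup>2"
    using xy by simp
  have tr: "trace T = trace A"
    unfolding TA trace_mul_sym[of _ "mat_adj V"] using V by (simp add: matrix_mul_assoc unitary_cancel)
  have "det V * det (mat_adj V) = 1"
    using V by (metis det_mul unitary_cancel(2) det_I)
  then have dt: "det T = det A"
    unfolding TA by (simp add: det_mul)
  have ww: "w * cnj w = 1"
    using w by (simp add: cnj_mult_self)
  have xyc: "x * cnj x + y * cnj y = 1"
    unfolding cnj_mult_self of_real_add[symmetric] xy by simp
  show thesis
  proof (rule that[OF st w])
    show "cmod x \<le> 1"
      using xy zero_le_power2[of "cmod y"] by (metis abs_norm_cancel abs_square_le_1 le_add_same_cancel1)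
    show "trace T = of_real s * x + of_real t * (w * cnj x)"
      unfolding tr unfolding trace_2 A_def by (simp add: mult_ac)
    show "det T = of_real (s * t) * w"
      unfolding dt unfolding det_2 A_def using xyc by simp algebra
    show N: "(norm T)\<^sup>2 = s\<^sup>2 + t\<^sup>2"
    proof -
      have "(norm A)\<^sup>2 = (s\<^sup>2 + t\<^sup>2) * ((cmod x)\<^sup>2 + (cmod y)\<^sup>2)"
        unfolding norm_2_sq A_def using w by (simp add: norm_mult power_mult_distrib algebra_simps)
      then show ?thesis
        unfolding TA norm_unitary_conj[OF V] xy by simp
    qed
    have "(norm A')\<^sup>2 = (s\<^sup>2 + t\<^sup>2) * (cmod x)\<^sup>2 + 2 * u\<^sup>2 * (cmod y)\<^sup>2"
      unfolding norm_2_sq A'_def using w by (simp add: norm_mult power_mult_distrib algebra_simps)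
    then show "(norm (aluthge (1/2) T))\<^sup>2 = (norm T)\<^sup>2 - (1 - (cmod x)\<^sup>2) * (s - t)\<^sup>2"
      unfolding TA' N norm_unitary_conj[OF V] u y by (simp add: power2_eq_square algebra_simps)
    have "A' - A = mat2 0 (of_real (u - t) * y) (of_real (s - u) * (w * cnj y)) 0"
      by (simp add: matrix2_eq_iff A_def A'_def algebra_simps)
    then have "(norm (A' - A))\<^sup>2 = ((u - t)\<^sup>2 + (s - u)\<^sup>2) * (cmod y)\<^sup>2"
      using w by (simp add: norm_2_sq norm_mult power_mult_distrib distrib_right del: of_real_diff)
    \<comment> \<open>The geometric mean lies between \<open>t\<close> and \<open>s\<close>; in
      expanded form this is \<open>u\<^sup>2 = s * t\<close> together with
      \<open>2 * u \<le> s + t\<close>.\<close>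
    moreover have "(u - t)\<^sup>2 + (s - u)\<^sup>2 \<le> (s - t)\<^sup>2"
    proof -
      have "(s - t)\<^sup>2 - ((u - t)\<^sup>2 + (s - u)\<^sup>2) = 2 * (u * (s + t - 2 * u)) + 2 * (u\<^sup>2 - s * t)"
        by (simp add: power2_eq_square algebra_simps)
      then have "0 \<le> (s - t)\<^sup>2 - ((u - t)\<^sup>2 + (s - u)\<^sup>2)"
        using u by simp
      then show ?thesis
        unfolding diff_ge_0_iff_ge .
    qed
    ultimately show "(norm (aluthge (1/2) T - T))\<^sup>2 \<le> (1 - (cmod x)\<^sup>2) * (s - t)\<^sup>2"
      unfolding diff norm_unitary_conj[OF V] y[symmetric] by (simp add: mult.commute mult_left_mono)
  qed
qed

text \<open>For a matrix with singular values s, t and eigenvalues a, b, both sides are half the squared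
  Frobenius norm of T*T - TT*, computed from the polar decomposition and from the Schur form.\<close>

lemma excess_identity:
  fixes a b x w :: complex and s t :: real
  assumes "a + b = of_real s * x + of_real t * (w * cnj x)" "a * b = of_real (s * t) * w" "cmod w = 1"
  shows "(1 - (cmod x)\<^sup>2) * (s\<^sup>2 - t\<^sup>2)\<^sup>2
    = (s\<^sup>2 + t\<^sup>2 - ((cmod a)\<^sup>2 + (cmod b)\<^sup>2)) * (s\<^sup>2 + t\<^sup>2 - ((cmod a)\<^sup>2 + (cmod b)\<^sup>2) + (cmod (a - b))\<^sup>2)"
proof -
  define S T' where "S = complex_of_real s" and "T' = complex_of_real t"
  have eqs: "a + b = S * x + T' * (w * cnj x)" "a * b = S * T' * w"
    using assms by (simp_all add: S_def T'_def)
  have cnj_eqs: "cnj a + cnj b = S * cnj x + T' * (cnj w * x)" "cnj a * cnj b = S * T' * cnj w"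
    using arg_cong[OF eqs(1), of cnj] arg_cong[OF eqs(2), of cnj] by (simp_all add: S_def T'_def)
  have "w * cnj w = 1"
    using assms by (simp add: cnj_mult_self)
  \<comment> \<open>The conjugates count as further variables, tied to the others by their own two
    equations and by \<open>w * cnj w = 1\<close>. The claim is a polynomial consequence of
    these.\<close>
  with eqs cnj_eqs have "(1 - x * cnj x) * (S * S - T' * T')\<^sup>2
    = (S * S + T' * T' - (a * cnj a + b * cnj b)) * (S * S + T' * T' - (a * cnj a + b * cnj b) + (a - b) * (cnj a - cnj b))"
    by algebra
  then have "complex_of_real ((1 - (cmod x)\<^sup>2) * (s\<^sup>2 - t\<^sup>2)\<^sup>2)
    = complex_of_real ((s\<^sup>2 + t\<^sup>2 - ((cmod a)\<^sup>2 + (cmod b)\<^sup>2)) * (s\<^sup>2 + t\<^sup>2 - ((cmod a)\<^sup>2 + (cmod b)\<^sup>2) + (cmod (a - b))\<^sup>2))"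
    unfolding S_def T'_def complex_cnj_diff[symmetric] cnj_mult_self by (simp add: power2_eq_square)
  then show ?thesis
    unfolding of_real_eq_iff .
qed

lemma parallelogram_cmod: "(cmod (a + b))\<^sup>2 + (cmod (a - b))\<^sup>2 = 2 * ((cmod a)\<^sup>2 + (cmod b)\<^sup>2)"
  unfolding cmod_power2 by (simp add: power2_eq_square algebra_simps)

text \<open>A bound for the factor by which one transform with parameter 1/2 shrinks the excess of
  the squared norm, see \<open>aluthge_half_estimates\<close>.\<close>

definition decay :: "complex \<Rightarrow> complex \<Rightarrow> real" where
  "decay a b = 1 - (cmod (a - b))\<^sup>2 / (cmod a + cmod b)\<^sup>2"

lemma decay_bounds:
  assumes "a \<noteq> b"
  shows "0 \<le> decay a b" "decay a b < 1"
proof -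
  have "cmod (a - b) \<le> cmod a + cmod b"
    by (rule norm_triangle_ineq4)
  moreover have "0 < cmod (a - b)"
    using assms by simp
  ultimately have "0 < (cmod a + cmod b)\<^sup>2" "(cmod (a - b))\<^sup>2 \<le> (cmod a + cmod b)\<^sup>2"
    by (auto intro: power_mono)
  then show "0 \<le> decay a b" "decay a b < 1"
    using assms by (simp_all add: decay_def)
qed

text \<open>The first claim is Schur's inequality. For the second, the drop of the squared norm
  equals \<open>c * (c + E) / (c + M)\<close>: divide \<open>excess_identity\<close> by
  \<open>(s + t)\<^sup>2\<close>, which is \<open>c + M\<close> because \<open>s * t\<close> is the
  modulus of the determinant. As \<open>E \<le> M\<close>, the drop is at least
  \<open>c * (E / M)\<close>.\<close>

lemma aluthge_half_estimates:
  fixes T :: "complex^2^2"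
  assumes tr: "trace T = a + b" and dt: "det T = a * b" and ab: "a \<noteq> b" "a * b \<noteq> 0"
  defines "n0 \<equiv> (cmod a)\<^sup>2 + (cmod b)\<^sup>2"
  shows "n0 \<le> (norm T)\<^sup>2"
    and "(norm (aluthge (1/2) T))\<^sup>2 - n0 \<le> decay a b * ((norm T)\<^sup>2 - n0)"
    and "(norm (aluthge (1/2) T - T))\<^sup>2 \<le> (norm T)\<^sup>2 - (norm (aluthge (1/2) T))\<^sup>2"
proof -
  have "det T \<noteq> 0"
    using dt ab by simp
  from aluthge_half_2[OF this] obtain s t x w where st: "0 < s" "0 < t" and w: "cmod w = 1" and x: "cmod x \<le> 1"
    and tr': "trace T = of_real s * x + of_real t * (w * cnj x)" and dt': "det T = of_real (s * t) * w"
    and N: "(norm T)\<^sup>2 = s\<^sup>2 + t\<^sup>2"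
    and N': "(norm (aluthge (1/2) T))\<^sup>2 = (norm T)\<^sup>2 - (1 - (cmod x)\<^sup>2) * (s - t)\<^sup>2"
    and diff: "(norm (aluthge (1/2) T - T))\<^sup>2 \<le> (1 - (cmod x)\<^sup>2) * (s - t)\<^sup>2"
    by metis
  show "(norm (aluthge (1/2) T - T))\<^sup>2 \<le> (norm T)\<^sup>2 - (norm (aluthge (1/2) T))\<^sup>2"
    using diff N' by simp
  define c E M where "c = (norm T)\<^sup>2 - n0" and "E = (cmod (a - b))\<^sup>2" and "M = (cmod a + cmod b)\<^sup>2"
  have key: "(1 - (cmod x)\<^sup>2) * (s\<^sup>2 - t\<^sup>2)\<^sup>2 = c * (c + E)"
    using excess_identity[of a b s x t w] tr dt tr' dt' w by (simp add: c_def E_def N n0_def)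
  have st_ab: "s * t = cmod a * cmod b"
    using arg_cong[OF dt', of cmod] st w dt by (simp add: norm_mult)
  have cM: "(s + t)\<^sup>2 = c + M"
    using st_ab unfolding c_def M_def N n0_def by (simp add: power2_sum mult.assoc)
  have E: "0 < E"
    using ab by (simp add: E_def)
  have EM: "E \<le> M"
    unfolding E_def M_def by (intro power_mono norm_triangle_ineq4 norm_ge_zero)
  have c: "0 \<le> c"
  proof (rule ccontr)
    \<comment> \<open>By \<open>key\<close>, a negative \<open>c\<close> forces
      \<open>c + E \<le> 0\<close>. But the trace bounds the norm from below, and with the
      parallelogram law this gives \<open>c \<ge> - E / 2\<close>.\<close>
    assume "\<not> 0 \<le> c"
    have "0 \<le> 1 - (cmod x)\<^sup>2"
      using x by (simp add: power_le_one)
    then have "0 \<le> c * (c + E)"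
      unfolding key[symmetric] by simp
    then have "c + E \<le> 0"
      using \<open>\<not> 0 \<le> c\<close> by (simp add: zero_le_mult_iff)
    have "cmod (a + b) \<le> s * cmod x + t * cmod x"
      using norm_triangle_ineq[of "of_real s * x" "of_real t * (w * cnj x)"] tr tr' st w by (simp add: norm_mult)
    also have "\<dots> \<le> s * 1 + t * 1"
      using x st by (intro add_mono mult_left_mono) auto
    finally have "(cmod (a + b))\<^sup>2 \<le> (s + t)\<^sup>2"
      by (intro power_mono) auto
    also have "\<dots> \<le> 2 * (norm T)\<^sup>2"
      using sum_squares_bound[of s t] unfolding N by (simp add: power2_sum)
    finally have "2 * n0 - E \<le> 2 * (norm T)\<^sup>2"
      using parallelogram_cmod[of a b] by (simp add: n0_def E_def)
    then show False
      using \<open>c + E \<le> 0\<close> E unfolding c_def by linarith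
  qed
  then show "n0 \<le> (norm T)\<^sup>2"
    by (simp add: c_def)
  have M: "0 < M" "0 < c + M"
    using E EM c by linarith+
  have "(1 - (cmod x)\<^sup>2) * (s - t)\<^sup>2 * (c + M) = c * (c + E)"
    unfolding cM[symmetric] key[symmetric] by (simp add: power2_eq_square algebra_simps)
  then have eq: "(1 - (cmod x)\<^sup>2) * (s - t)\<^sup>2 = c * (c + E) / (c + M)"
    using M by (simp add: field_simps)
  have "E / M \<le> (c + E) / (c + M)"
    using M c EM by (simp add: field_simps mult_right_mono)
  then have "c * (E / M) \<le> (1 - (cmod x)\<^sup>2) * (s - t)\<^sup>2"
    unfolding eq times_divide_eq_right[symmetric] using c by (rule mult_left_mono)
  then show "(norm (aluthge (1/2) T))\<^sup>2 - n0 \<le> decay a b * ((norm T)\<^sup>2 - n0)"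
    unfolding N' c_def[symmetric] decay_def E_def[symmetric] M_def[symmetric]
    by (simp add: c_def algebra_simps)
qed

lemma aluthge_funpow_det_trace:
  fixes T :: "complex^2^2"
  assumes "det T \<noteq> 0"
  shows "det ((aluthge l ^^ n) T) = det T" "trace ((aluthge l ^^ n) T) = trace T"
proof -
  have "det ((aluthge l ^^ n) T) = det T \<and> trace ((aluthge l ^^ n) T) = trace T"
    by (induction n) (simp_all add: assms aluthge_det_trace)
  then show "det ((aluthge l ^^ n) T) = det T" "trace ((aluthge l ^^ n) T) = trace T"
    by auto
qed

lemma convergent_if_summable_increments:
  fixes X :: "nat \<Rightarrow> 'a::banach"
  assumes "summable (\<lambda>n. norm (X (Suc n) - X n))"
  shows "convergent X"
proof -
  have "convergent (\<lambda>n. \<Sum>i<n. X (Suc i) - X i)"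
    using summable_norm_cancel[OF assms] by (simp add: summable_iff_convergent)
  then have "convergent (\<lambda>n. X n - X 0)"
    unfolding sum_lessThan_telescope .
  then have "convergent (\<lambda>n. (X n - X 0) + X 0)"
    by (intro convergent_add convergent_const)
  then show ?thesis by simp
qed

text \<open>Each squared step is at most \<open>c n - c (Suc n)\<close>, hence at most
  \<open>c n\<close>, which decays geometrically. The steps are thus dominated by a geometric series
  with ratio \<open>sqrt (decay a b)\<close>.\<close>

lemma aluthge_half_tendsto:
  fixes T :: "complex^2^2"
  assumes tr: "trace T = a + b" and dt: "det T = a * b" and ab: "a \<noteq> b" "a * b \<noteq> 0"
  shows "(\<lambda>n. (aluthge (1/2) ^^ n) T) \<longlonglongrightarrow> aluthge_limit (1/2) T"
proof -
  define X where "X n = (aluthge (1/2) ^^ n) T" for n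
  define c where "c n = (norm (X n))\<^sup>2 - ((cmod a)\<^sup>2 + (cmod b)\<^sup>2)" for n
  have "det T \<noteq> 0" using dt ab by simp
  note dt_tr = aluthge_funpow_det_trace[OF this, where l = "1/2", folded X_def]
  have Suc: "X (Suc n) = aluthge (1/2) (X n)" for n
    by (simp add: X_def)
  have est: "0 \<le> c n" "c (Suc n) \<le> decay a b * c n" "(norm (X (Suc n) - X n))\<^sup>2 \<le> c n - c (Suc n)" for n
    using aluthge_half_estimates[of "X n" a b] dt_tr[of n] ab unfolding tr dt Suc c_def by auto
  note \<rho> = decay_bounds[OF ab(1)]
  have c: "c n \<le> decay a b ^ n * c 0" for n
  proof (induction n)
    case (Suc n)
    have "c (Suc n) \<le> decay a b * c n"
      by (rule est)
    also have "\<dots> \<le> decay a b * (decay a b ^ n * c 0)"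
      by (intro mult_left_mono Suc \<rho>)
    finally show ?case by (simp add: mult_ac)
  qed simp
  have "norm (X (Suc n) - X n) \<le> sqrt (decay a b) ^ n * sqrt (c 0)" for n
  proof -
    have "(norm (X (Suc n) - X n))\<^sup>2 \<le> c n"
      using est(3)[of n] est(1)[of "Suc n"] by linarith
    also note c[of n]
    finally show ?thesis
      by (metis real_le_rsqrt real_sqrt_mult real_sqrt_power)
  qed
  then have "summable (\<lambda>n. norm (X (Suc n) - X n))"
    using \<rho> by (intro summable_comparison_test'[OF summable_mult2[OF summable_geometric], of "sqrt (decay a b)" 0]) auto
  from convergent_if_summable_increments[OF this] show ?thesis
    unfolding convergent_LIMSEQ_iff aluthge_limit_def X_def .
qed

text \<open>The two sequences differ by a shift, so they have the same limits. Since
  \<open>lim\<close> depends only on which values are limits, the equation holds for every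
  \<open>l\<close> without knowing convergence.\<close>

lemma aluthge_limit_aluthge: "aluthge_limit l (aluthge l T) = aluthge_limit l T"
proof -
  have "(aluthge l ^^ n) (aluthge l T) = (aluthge l ^^ Suc n) T" for n
    by (simp only: funpow_Suc_right o_apply)
  then show ?thesis
    unfolding aluthge_limit_def lim_def by (simp only: filterlim_sequentially_Suc[where f = "\<lambda>n. (aluthge l ^^ n) T"])
qed

lemma tendsto_mult_2:
  fixes A B :: "complex^2^2"
  assumes "(f \<longlongrightarrow> A) F" "(g \<longlongrightarrow> B) F"
  shows "((\<lambda>n. f n ** g n) \<longlongrightarrow> A ** B) F"
  unfolding mult2_nth by (intro vec_tendstoI) (auto simp: mult2_nth intro!: tendsto_add tendsto_mult tendsto_vec_nth assms)

lemma tendsto_map_matrix_cnj: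
  fixes A :: "complex^'n^'m"
  assumes "(f \<longlongrightarrow> A) F"
  shows "((\<lambda>n. map_matrix cnj (f n)) \<longlongrightarrow> map_matrix cnj A) F"
  by (intro vec_tendstoI) (auto simp: map_matrix_def intro!: tendsto_cnj tendsto_vec_nth assms)

section \<open>The limit for parameter 1/2 and its symmetries\<close>

context
  fixes a b :: complex
  assumes ab: "a \<noteq> b" "a * b \<noteq> 0"
begin

text \<open>Fixing the eigenvalues through the coefficients of the characteristic polynomial makes
  the condition invariant under all transforms and closed under limits.\<close>

definition has_spectrum :: "complex^2^2 \<Rightarrow> bool" where
  "has_spectrum T \<longleftrightarrow> trace T = a + b \<and> det T = a * b"

lemma has_spectrum_det: "has_spectrum T \<Longrightarrow> det T \<noteq> 0"
  using ab by (simp add: has_spectrum_def)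

lemma has_spectrum_aluthge: "has_spectrum T \<Longrightarrow> has_spectrum (aluthge l T)"
  using has_spectrum_det[of T] by (simp add: has_spectrum_def aluthge_det_trace)

lemma has_spectrum_funpow: "has_spectrum T \<Longrightarrow> has_spectrum ((aluthge l ^^ n) T)"
  by (induction n) (simp_all add: has_spectrum_aluthge)

lemma aluthge_limit_tendsto: "has_spectrum T \<Longrightarrow> (\<lambda>n. (aluthge (1/2) ^^ n) T) \<longlonglongrightarrow> aluthge_limit (1/2) T"
  using aluthge_half_tendsto[OF _ _ ab] by (simp add: has_spectrum_def)

lemma aluthge_limitI: "(\<lambda>n. (aluthge (1/2) ^^ n) T) \<longlonglongrightarrow> L \<Longrightarrow> aluthge_limit (1/2) T = L"
  unfolding aluthge_limit_def by (rule limI)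

lemma has_spectrum_aluthge_limit:
  assumes "has_spectrum T"
  shows "has_spectrum (aluthge_limit (1/2) T)"
proof -
  note lim = aluthge_limit_tendsto[OF assms]
  have "(\<lambda>n. trace ((aluthge (1/2) ^^ n) T)) \<longlonglongrightarrow> trace (aluthge_limit (1/2) T)"
    "(\<lambda>n. det ((aluthge (1/2) ^^ n) T)) \<longlonglongrightarrow> det (aluthge_limit (1/2) T)"
    unfolding trace_2 det_2 by (intro tendsto_intros tendsto_vec_nth lim)+
  moreover have "trace ((aluthge (1/2) ^^ n) T) = a + b" "det ((aluthge (1/2) ^^ n) T) = a * b" for n
    using has_spectrum_funpow[OF assms] by (auto simp: has_spectrum_def)
  ultimately show ?thesis
    unfolding has_spectrum_def using LIMSEQ_unique[OF _ tendsto_const] by auto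
qed

lemma aluthge_limit_unitary_conj:
  assumes "has_spectrum T" "unitary_mat W"
  shows "aluthge_limit (1/2) (W ** T ** mat_adj W) = W ** aluthge_limit (1/2) T ** mat_adj W"
proof (rule aluthge_limitI)
  have "(aluthge (1/2) ^^ n) (W ** T ** mat_adj W) = W ** (aluthge (1/2) ^^ n) T ** mat_adj W" for n
    by (induction n)
      (simp_all add: aluthge_unitary_conj assms has_spectrum_det has_spectrum_funpow)
  then show "(\<lambda>n. (aluthge (1/2) ^^ n) (W ** T ** mat_adj W)) \<longlonglongrightarrow> W ** aluthge_limit (1/2) T ** mat_adj W"
    by (simp only:) (intro tendsto_mult_2 tendsto_const aluthge_limit_tendsto assms)
qed

lemma aluthge_limit_cnj:
  assumes "has_spectrum T" "cmod z = 1"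
  shows "aluthge_limit (1/2) (mat z ** map_matrix cnj T) = mat z ** map_matrix cnj (aluthge_limit (1/2) T)"
proof (rule aluthge_limitI)
  have "(aluthge (1/2) ^^ n) (mat z ** map_matrix cnj T) = mat z ** map_matrix cnj ((aluthge (1/2) ^^ n) T)" for n
    by (induction n)
      (simp_all add: aluthge_cnj assms has_spectrum_det has_spectrum_funpow)
  then show "(\<lambda>n. (aluthge (1/2) ^^ n) (mat z ** map_matrix cnj T)) \<longlonglongrightarrow> mat z ** map_matrix cnj (aluthge_limit (1/2) T)"
    by (simp only:) (intro tendsto_mult_2 tendsto_const tendsto_map_matrix_cnj aluthge_limit_tendsto assms)
qed

text \<open>The iteration on the large matrix stays among the embedded blocks, so its convergence is
  that of the 2x2 iteration.\<close>

lemma aluthge_limit_embed2: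
  assumes "has_spectrum T" "i \<noteq> j" "\<And>k. d k \<noteq> 0"
  shows "aluthge_limit (1/2) (embed2 i j d T) = embed2 i j d (aluthge_limit (1/2) T)"
proof (rule aluthge_limitI)
  have "(aluthge (1/2) ^^ n) (embed2 i j d T) = embed2 i j d ((aluthge (1/2) ^^ n) T)" for n
    by (induction n)
      (simp_all add: aluthge_embed2 assms has_spectrum_det has_spectrum_funpow)
  then show "(\<lambda>n. (aluthge (1/2) ^^ n) (embed2 i j d T)) \<longlonglongrightarrow> embed2 i j d (aluthge_limit (1/2) T)"
    by (simp only:) (intro tendsto_embed2 aluthge_limit_tendsto assms)
qed

end

section \<open>Rotation-like matrices\<close>

text \<open>For e = t and f = s this is a unitary matrix times diag(s, t); the Aluthge transforms only change
  e and f, and replacing l by 1 - l exchanges them.\<close>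

definition rotor :: "complex \<Rightarrow> complex \<Rightarrow> real \<Rightarrow> real \<Rightarrow> real \<Rightarrow> real \<Rightarrow> real \<Rightarrow> complex^2^2" where
  "rotor \<gamma> x y s t e f = mat2 (\<gamma> * (s * x)) (\<gamma> * (e * y)) (- \<gamma> * (f * y)) (\<gamma> * (t * cnj x))"

text \<open>This is the normal form with \<open>V\<close> the identity. On the diagonal the
  exponents \<open>l\<close> and \<open>1 - l\<close> meet on the same base and restore s and t; off
  the diagonal they fall on different bases.\<close>

lemma aluthge_rotor:
  assumes "cmod \<gamma> = 1" "(cmod x)\<^sup>2 + y\<^sup>2 = 1" "0 < s" "0 < t"
  shows "aluthge l (rotor \<gamma> x y s t t s)
    = rotor \<gamma> x y s t (s powr l * t powr (1 - l)) (s powr (1 - l) * t powr l)"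
proof -
  define \<sigma> :: "2 \<Rightarrow> real" where "\<sigma> i = (if i = 1 then s else t)" for i
  have \<sigma>: "0 < \<sigma> i" for i
    using assms by (simp add: \<sigma>_def)
  define X where "X = mat2 (\<gamma> * x) (\<gamma> * y) (- \<gamma> * y) (\<gamma> * cnj x)"
  have "\<gamma> * cnj \<gamma> = 1"
    using assms by (simp add: cnj_mult_self)
  then have "X = mat2 (\<gamma> * x) (\<gamma> * y) (- (\<gamma> * \<gamma>) * cnj (\<gamma> * y)) ((\<gamma> * \<gamma>) * cnj (\<gamma> * x))"
    by (simp add: X_def matrix2_eq_iff mult.assoc)
  moreover have "cmod (\<gamma> * \<gamma>) = 1" "(cmod (\<gamma> * x))\<^sup>2 + (cmod (\<gamma> * y))\<^sup>2 = 1"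
    using assms by (simp_all add: norm_mult)
  ultimately have X: "unitary_mat X"
    unfolding unitary_2_iff by blast
  have I: "unitary_mat (mat 1 :: complex^2^2)" "mat_adj (mat 1 :: complex^2^2) = mat 1"
    by (simp_all add: unitary_mat_def matrix2_eq_iff mult2_nth mat_adj_nth)
  have "rotor \<gamma> x y s t t s = mat 1 ** X ** rdiag \<sigma> ** mat_adj (mat 1)"
    by (simp add: I matrix2_eq_iff diag_of_mult_right rotor_def X_def \<sigma>_def mult_ac)
  then have "aluthge l (rotor \<gamma> x y s t t s)
      = mat 1 ** rdiag (\<lambda>i. \<sigma> i powr l) ** X ** rdiag (\<lambda>i. \<sigma> i powr (1 - l)) ** mat_adj (mat 1)"
    by (simp only: aluthge_normal_form[OF I(1) X \<sigma>])
  moreover have "s powr l * s powr (1 - l) = s" "t powr l * t powr (1 - l) = t"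
    using assms by (simp_all add: powr_add[symmetric])
  then have "complex_of_real (s powr l) * complex_of_real (s powr (1 - l)) = s"
    "complex_of_real (t powr l) * complex_of_real (t powr (1 - l)) = t"
    by (metis of_real_mult)+
  ultimately show ?thesis
    by (simp add: I matrix2_eq_iff diag_of_mult_right diag_of_mult_left rotor_def X_def \<sigma>_def)
qed

text \<open>Commuting with \<open>W\<close> gives a relation that contains only the imaginary part
  of \<open>G\<close>, and this depends on \<open>e\<close> and \<open>f\<close> only through their
  sum. If \<open>Im x \<noteq> 0\<close>, two parameters with different sums therefore leave only
  scalar matrices.\<close>

lemma rotor_swap:
  fixes s t e f y :: real
  assumes "cmod \<gamma> = 1" "y \<noteq> 0" "e \<noteq> f" "e + f \<noteq> 0"
  obtains W where "unitary_mat W" "W ** rotor \<gamma> x y s t e f ** mat_adj W = rotor \<gamma> x y s t f e"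
    "\<And>L. W ** L ** mat_adj W = L \<Longrightarrow> L$2$1 = - L$1$2 \<and>
      L$1$1 - L$2$2 = 2 * \<i> * of_real ((s + t) * Im x / ((e + f) * y)) * L$1$2"
proof -
  \<comment> \<open>the solution of the equation \<open>key\<close> below, which is the only condition for W to intertwine\<close>
  define G where "G = Complex ((s - t) * Re x / ((e - f) * y)) ((s + t) * Im x / ((e + f) * y))"
  define \<nu> where "\<nu> = sqrt ((cmod G)\<^sup>2 + 1)"
  have \<nu>: "\<nu>\<^sup>2 = (cmod G)\<^sup>2 + 1" "\<nu> \<noteq> 0"
    by (simp_all add: \<nu>_def add_nonneg_pos less_imp_neq[symmetric])
  define W where "W = mat2 (G / \<nu>) (1 / \<nu>) (- 1 / \<nu>) (cnj G / \<nu>)"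
  have "(cmod (G / \<nu>))\<^sup>2 + (cmod (1 / \<nu>))\<^sup>2 = ((cmod G)\<^sup>2 + 1) / \<nu>\<^sup>2"
    by (simp add: norm_divide power_divide add_divide_distrib)
  also have "\<dots> = 1"
    unfolding \<nu>(1)[symmetric] using \<nu>(2) by simp
  finally have "(cmod (G / \<nu>))\<^sup>2 + (cmod (1 / \<nu>))\<^sup>2 = 1" .
  moreover have "W = mat2 (G / \<nu>) (1 / \<nu>) (- 1 * cnj (1 / \<nu>)) (1 * cnj (G / \<nu>))"
    by (simp add: W_def)
  ultimately have W: "unitary_mat W"
    unfolding unitary_2_iff by (metis norm_one)
  have key: "y * (G * e - cnj G * f) = s * x - t * cnj x"
  proof -
    have "y * (e - f) * Re G = (s - t) * Re x" "y * (e + f) * Im G = (s + t) * Im x"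
      using assms by (simp_all add: G_def)
    then show ?thesis
      by (simp add: complex_eq_iff algebra_simps)
  qed
  have "W ** rotor \<gamma> x y s t e f = rotor \<gamma> x y s t f e ** W"
    using arg_cong[OF key, of "(*) \<gamma>"] \<nu>(2)
    by (simp add: matrix2_eq_iff mult2_nth W_def rotor_def field_simps)
  then have "W ** rotor \<gamma> x y s t e f ** mat_adj W = rotor \<gamma> x y s t f e"
    using W by (simp add: matrix_mul_assoc[symmetric] unitary_cancel)
  moreover have "L$2$1 = - L$1$2 \<and> L$1$1 - L$2$2 = 2 * \<i> * of_real ((s + t) * Im x / ((e + f) * y)) * L$1$2"
    if "W ** L ** mat_adj W = L" for L
  proof -
    have "W ** L = L ** W"
      using W arg_cong[OF that, of "\<lambda>M. M ** W"] by (simp add: matrix_mul_assoc[symmetric] unitary_cancel)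
    then have L: "L$2$1 + L$1$2 = 0" "G * L$1$2 + L$2$2 = L$1$1 + cnj G * L$1$2"
      using \<nu>(2) by (simp_all add: matrix2_eq_iff mult2_nth W_def field_simps)
    have "L$1$1 - L$2$2 = (G - cnj G) * L$1$2"
      using L(2) by algebra
    moreover have "G - cnj G = 2 * \<i> * of_real (Im G)"
      by (simp add: complex_eq_iff)
    moreover have "Im G = (s + t) * Im x / ((e + f) * y)"
      by (simp add: G_def)
    ultimately show ?thesis
      using L(1) by (simp only: eq_neg_iff_add_eq_0)
  qed
  ultimately show thesis
    using that[OF W] by blast
qed

text \<open>With q = s / t > 1 both sides are t times a sum of two powers of q, and the difference
  of these sums factors into two positive terms. It shows that the sum of the off-diagonal weights
  really changes with the parameter.\<close>

lemma powr_sum_strict_mono: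
  fixes s t l m :: real
  assumes "0 < t" "t < s" "m < l" "1 < l + m"
  shows "s powr m * t powr (1 - m) + s powr (1 - m) * t powr m < s powr l * t powr (1 - l) + s powr (1 - l) * t powr l"
proof -
  have *: "s powr a * t powr (1 - a) = t * (s / t) powr a" for a
    using assms by (simp add: powr_divide powr_diff)
  define q where "q = s / t"
  have "1 < q"
    using assms by (simp add: q_def)
  then have "0 < (q powr l - q powr m) * (1 - q powr (1 - l - m))"
    using assms by (intro mult_pos_pos) (simp_all add: powr_less_one)
  also have "\<dots> = q powr l + q powr (1 - l) - (q powr m + q powr (1 - m))"
    using \<open>1 < q\<close> by (simp add: algebra_simps powr_add[symmetric])
  finally have "t * (q powr m + q powr (1 - m)) < t * (q powr l + q powr (1 - l))"
    using assms by simp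
  then show ?thesis
    using *[of l] *[of m] *[of "1 - l"] *[of "1 - m"] by (simp add: q_def distrib_left)
qed

text \<open>Taking for \<open>\<gamma>\<close> a square root of the phase of \<open>a * b\<close>
  gives \<open>a = \<gamma> * (r1 * \<kappa>)\<close> and
  \<open>b = \<gamma> * (r2 * cnj \<kappa>)\<close>. The trace condition then determines
  \<open>x\<close> by rescaling the real and imaginary parts of \<open>\<kappa>\<close>. Both
  factors are below 1, so \<open>cmod x < 1\<close>, which leaves room for
  \<open>y > 0\<close>.\<close>

lemma rotor_parameters:
  fixes a b :: complex
  assumes "b \<noteq> 0" "cmod b < cmod a"
  obtains \<gamma> x :: complex and y s t :: real where "cmod \<gamma> = 1" "(cmod x)\<^sup>2 + y\<^sup>2 = 1" "0 < y" "0 < t" "t < s"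
    "\<gamma> * (s * x + t * cnj x) = a + b" "\<gamma>\<^sup>2 * (s * t) = a * b"
proof -
  define r1 r2 where "r1 = cmod a" and "r2 = cmod b"
  have r: "0 < r2" "r2 < r1" "a \<noteq> 0"
    using assms by (auto simp: r1_def r2_def)
  define \<gamma> where "\<gamma> = csqrt (sgn a * sgn b)"
  have \<gamma>2: "\<gamma>\<^sup>2 = sgn a * sgn b"
    by (simp add: \<gamma>_def)
  have "(cmod \<gamma>)\<^sup>2 = 1"
    unfolding norm_power[symmetric] \<gamma>2 using assms r by (simp add: norm_mult norm_sgn)
  then have \<gamma>: "cmod \<gamma> = 1"
    using norm_ge_zero[of \<gamma>] by (auto simp: power2_eq_1_iff)
  then have "\<gamma> \<noteq> 0" by auto
  define \<kappa> where "\<kappa> = sgn a / \<gamma>"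
  have \<kappa>: "cmod \<kappa> = 1"
    using r \<gamma> by (simp add: \<kappa>_def norm_divide norm_sgn)
  have "a = r1 * sgn a" "b = r2 * sgn b"
    by (simp_all add: r1_def r2_def sgn_eq assms r)
  moreover have "sgn a = \<gamma> * \<kappa>"
    using \<open>\<gamma> \<noteq> 0\<close> by (simp add: \<kappa>_def)
  moreover from this have "sgn b = \<gamma> * cnj \<kappa>"
  proof -
    have "\<kappa> * sgn b = \<gamma>"
      using \<gamma>2 \<open>sgn a = \<gamma> * \<kappa>\<close> \<open>\<gamma> \<noteq> 0\<close> by (simp add: power2_eq_square)
    then have "cnj \<kappa> * \<kappa> * sgn b = cnj \<kappa> * \<gamma>"
      by simp
    then show ?thesis
      using \<kappa> by (simp add: cnj_mult_self mult.commute)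
  qed
  ultimately have a: "a = \<gamma> * (r1 * \<kappa>)" and b: "b = \<gamma> * (r2 * cnj \<kappa>)"
    by (simp_all add: mult_ac)
  \<comment> \<open>any s, t with s t = r1 r2 and s > r1 would do\<close>
  define s t where "s = 2 * r1" and "t = r2 / 2"
  have st: "0 < t" "t < s" "0 \<le> (r1 + r2) / (s + t)" "(r1 + r2) / (s + t) < 1" "0 \<le> (r1 - r2) / (s - t)" "(r1 - r2) / (s - t) < 1"
    using r by (simp_all add: s_def t_def field_simps)
  define x where "x = Complex ((r1 + r2) / (s + t) * Re \<kappa>) ((r1 - r2) / (s - t) * Im \<kappa>)"
  have le: "p\<^sup>2 * z\<^sup>2 \<le> z\<^sup>2" "z \<noteq> 0 \<Longrightarrow> p\<^sup>2 * z\<^sup>2 < z\<^sup>2" if "0 \<le> p" "p < 1" for p z :: real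
  proof -
    have "p\<^sup>2 < 1"
      using that by (simp add: power_less_one_iff abs_square_less_1)
    then show "p\<^sup>2 * z\<^sup>2 \<le> z\<^sup>2" "z \<noteq> 0 \<Longrightarrow> p\<^sup>2 * z\<^sup>2 < z\<^sup>2"
      by (simp_all add: mult_left_le_one_le mult_less_cancel_right1 mult_le_cancel_right1 not_le)
  qed
  have "(Re \<kappa>)\<^sup>2 + (Im \<kappa>)\<^sup>2 = 1"
    using \<kappa> by (metis cmod_power2 one_power2)
  \<comment> \<open>Only a nonzero coordinate of \<open>\<kappa>\<close> shrinks strictly, hence the
    case split.\<close>
  moreover have "(cmod x)\<^sup>2 < (Re \<kappa>)\<^sup>2 + (Im \<kappa>)\<^sup>2"
  proof (cases "Re \<kappa> = 0")
    case True
    then have "Im \<kappa> \<noteq> 0"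
      using \<open>(Re \<kappa>)\<^sup>2 + (Im \<kappa>)\<^sup>2 = 1\<close> by auto
    then show ?thesis
      unfolding cmod_power2 x_def complex.sel power_mult_distrib
      by (intro add_le_less_mono le st)
  next
    case False
    then show ?thesis
      unfolding cmod_power2 x_def complex.sel power_mult_distrib
      by (intro add_less_le_mono le st)
  qed
  ultimately have x: "(cmod x)\<^sup>2 < 1" by simp
  show thesis
  proof (rule that[of \<gamma> x "sqrt (1 - (cmod x)\<^sup>2)" t s])
    have "s * x + t * cnj x = r1 * \<kappa> + r2 * cnj \<kappa>"
      using st by (simp add: complex_eq_iff x_def add_divide_distrib[symmetric] diff_divide_distrib[symmetric]
        distrib_right[symmetric] left_diff_distrib[symmetric] times_divide_eq_right[symmetric]
        del: times_divide_eq_right) (simp add: field_simps)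
    then show "\<gamma> * (s * x + t * cnj x) = a + b"
      by (simp add: a b distrib_left)
    have "\<kappa> * cnj \<kappa> = 1"
      using \<kappa> by (simp add: cnj_mult_self)
    then show "\<gamma>\<^sup>2 * (s * t) = a * b"
      unfolding a b s_def t_def by (simp add: power2_eq_square)
  qed (use \<gamma> x st in auto)
qed

text \<open>The core of the argument: one transform with parameter \<open>l\<close> can move the
  limit for parameter 1/2. The two conditions on the off-diagonal entry serve the diagonalization in
  \<open>embed2_in_similarity_orbit\<close>.\<close>

lemma aluthge_limit_not_constant_2:
  assumes "b \<noteq> 0" "cmod b < cmod a"
  obtains T l where "has_spectrum a b T" "T$1$2 \<noteq> 0" "(aluthge l T)$1$2 \<noteq> 0" "0 < l" "l < 1"
    "aluthge_limit (1/2) (aluthge l T) \<noteq> aluthge_limit (1/2) T"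
proof -
  have ab: "a \<noteq> b" "a * b \<noteq> 0"
    using assms by auto
  obtain \<gamma> x :: complex and y s t :: real where \<gamma>: "cmod \<gamma> = 1" and xy: "(cmod x)\<^sup>2 + y\<^sup>2 = 1" and y: "0 < y"
    and st: "0 < t" "t < s" and tr: "\<gamma> * (s * x + t * cnj x) = a + b" and dt: "\<gamma>\<^sup>2 * (s * t) = a * b"
    using rotor_parameters[OF assms] by metis
  have "0 < s" using st by simp
  define T where "T = rotor \<gamma> x y s t t s"
  define L where "L = aluthge_limit (1/2) T"
  define e where "e l = s powr l * t powr (1 - l)" for l
  have e: "0 < e l" for l
    using st by (simp add: e_def)
  have AT: "aluthge l T = rotor \<gamma> x y s t (e l) (e (1 - l))" for l
    unfolding T_def aluthge_rotor[OF \<gamma> xy \<open>0 < s\<close> st(1)] by (simp add: e_def)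
  have "\<gamma> \<noteq> 0" using \<gamma> by auto
  have xyc: "x * cnj x + of_real y * of_real y = 1"
    using arg_cong[OF xy, of complex_of_real] unfolding cnj_mult_self by (simp add: power2_eq_square)
  have T: "has_spectrum a b T"
    unfolding has_spectrum_def[OF ab] tr[symmetric] dt[symmetric] trace_2 det_2 T_def rotor_def
    using xyc by (simp add: algebra_simps) algebra
  have "\<exists>l. 0 < l \<and> l < 1 \<and> aluthge_limit (1/2) (aluthge l T) \<noteq> L"
  proof (rule ccontr)
    assume "\<nexists>l. 0 < l \<and> l < 1 \<and> aluthge_limit (1/2) (aluthge l T) \<noteq> L"
    then have const: "aluthge_limit (1/2) (aluthge l T) = L" if "0 < l" "l < 1" for l
      using that by blast
    \<comment> \<open>For \<open>l > 1/2\<close> the weights \<open>e l\<close> and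
      \<open>e (1 - l)\<close> differ because \<open>s > t\<close>, so \<open>rotor_swap\<close>
      applies. Constancy at both \<open>l\<close> and \<open>1 - l\<close> turns the swap into
      invariance of \<open>L\<close> under conjugation by \<open>W\<close>.\<close>
    have L: "L$2$1 = - L$1$2 \<and> L$1$1 - L$2$2 = 2 * \<i> * of_real ((s + t) * Im x / ((e l + e (1 - l)) * y)) * L$1$2"
      if l: "1/2 < l" "l < 1" for l
    proof -
      have "0 < l" "0 < 1 - l" "1 - l < 1"
        using l by simp_all
      have "e l = t * (s / t) powr l" for l
        using st by (simp add: e_def powr_divide powr_diff)
      then have "e (1 - l) < e l"
        using st l by simp
      then have "e l \<noteq> e (1 - l)"
        by simp
      moreover have "e l + e (1 - l) \<noteq> 0"
        using e[of l] e[of "1 - l"] by simp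
      moreover have "y \<noteq> 0"
        using y by simp
      ultimately obtain W where W: "unitary_mat W"
        and swap: "W ** rotor \<gamma> x y s t (e l) (e (1 - l)) ** mat_adj W = rotor \<gamma> x y s t (e (1 - l)) (e l)"
        and comm: "\<And>L. W ** L ** mat_adj W = L \<Longrightarrow> L$2$1 = - L$1$2 \<and>
          L$1$1 - L$2$2 = 2 * \<i> * of_real ((s + t) * Im x / ((e l + e (1 - l)) * y)) * L$1$2"
        using rotor_swap[OF \<gamma>] by metis
      have "W ** aluthge l T ** mat_adj W = aluthge (1 - l) T"
        unfolding AT swap by simp
      then have "W ** L ** mat_adj W = L"
        using aluthge_limit_unitary_conj[OF ab has_spectrum_aluthge[OF ab T] W, of l]
        by (simp only: const[OF \<open>0 < l\<close> l(2)] const[OF \<open>0 < 1 - l\<close> \<open>1 - l < 1\<close>])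
      then show ?thesis
        by (rule comm)
    qed
    have Lspec: "L$1$1 + L$2$2 = a + b" "L$1$1 * L$2$2 - L$1$2 * L$2$1 = a * b"
      using has_spectrum_aluthge_limit[OF ab T] unfolding has_spectrum_def[OF ab] L_def[symmetric] trace_2 det_2 by auto
    show False
    proof (cases "Im x = 0")
      \<comment> \<open>Now \<open>T\<close> is \<open>\<gamma>\<close> times a real matrix, hence
        so is \<open>L\<close>. Its rows are (p, v) and (-v, p), so its eigenvalues are p + iv and p
        - iv, and these have equal moduli since p and v are real multiples of
        \<open>\<gamma>\<close>.\<close>
      case True
      then have L': "L$2$1 = - L$1$2" "L$1$1 = L$2$2"
        using L[of "3/4"] by auto
      have "cnj x = x"
        using True by (simp add: complex_eq_iff)
      have "\<gamma>\<^sup>2 * cnj \<gamma> = \<gamma>"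
        using \<gamma> by (simp add: power2_eq_square mult.assoc cnj_mult_self)
      have "mat (\<gamma>\<^sup>2) ** map_matrix cnj T = T"
        unfolding matrix2_eq_iff mult2_nth T_def rotor_def map_matrix_def
        using \<open>\<gamma>\<^sup>2 * cnj \<gamma> = \<gamma>\<close> \<open>cnj x = x\<close> by simp
      then have "mat (\<gamma>\<^sup>2) ** map_matrix cnj L = L"
        using aluthge_limit_cnj[OF ab T, of "\<gamma>\<^sup>2"] \<gamma> unfolding L_def by (simp add: norm_power)
      then have "\<gamma>\<^sup>2 * cnj (L$2$2) = L$2$2" "\<gamma>\<^sup>2 * cnj (L$1$2) = L$1$2"
        by (simp_all add: matrix2_eq_iff mult2_nth map_matrix_def)
      define p v where "p = L$2$2" and "v = L$1$2"
      have pv: "\<gamma>\<^sup>2 * cnj p = p" "\<gamma>\<^sup>2 * cnj v = v"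
        using \<open>\<gamma>\<^sup>2 * cnj (L$2$2) = L$2$2\<close> \<open>\<gamma>\<^sup>2 * cnj (L$1$2) = L$1$2\<close> by (simp_all add: p_def v_def)
      have sp: "p + p = a + b" "p * p + v * v = a * b"
        using Lspec unfolding L' p_def[symmetric] v_def[symmetric] by simp_all
      \<comment> \<open>The square of \<open>a - b\<close> is the discriminant of the characteristic
        polynomial, which equals \<open>- 4 * v\<^sup>2\<close>; this leaves \<open>q = v\<close> or
        \<open>q = - v\<close>.\<close>
      have "(a - b - 2 * \<i> * v) * (a - b + 2 * \<i> * v) = (a + b)\<^sup>2 - 4 * (a * b) + 4 * v\<^sup>2"
        by (simp add: power2_eq_square algebra_simps)
      also have "\<dots> = 0"
        unfolding sp[symmetric] by (simp add: power2_eq_square algebra_simps)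
      finally have "a - b = 2 * \<i> * v \<or> a - b = 2 * \<i> * (- v)"
        by (auto simp: eq_neg_iff_add_eq_0)
      moreover have "\<gamma>\<^sup>2 * cnj (- v) = - v"
        using pv(2) by simp
      ultimately obtain q where q: "a - b = 2 * \<i> * q" "\<gamma>\<^sup>2 * cnj q = q"
        using pv(2) by metis
      have a: "a = p + \<i> * q" and b: "b = p - \<i> * q"
        using sp(1) q(1) by algebra+
      \<comment> \<open>Both numbers are real multiples of \<open>\<gamma>\<close>, so the product
        is real.\<close>
      have "p * cnj q = q * cnj p"
        using pv(1) q(2) by (metis mult.assoc mult.commute)
      then have "a * cnj a = b * cnj b"
        unfolding a b by (simp add: algebra_simps)
      then have "(cmod a)\<^sup>2 = (cmod b)\<^sup>2"
        unfolding cnj_mult_self of_real_eq_iff .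
      then show False
        using assms by simp
    next
      case False
      \<comment> \<open>Any two parameters between 1/2 and 1 would do. Their sums of weights differ,
        so the two relations for the same \<open>L\<close> have different coefficients and make
        \<open>L\<close> scalar, contradicting \<open>a \<noteq> b\<close>.\<close>
      have "e (2/3) + e (1 - 2/3) < e (3/4) + e (1 - 3/4)"
        using powr_sum_strict_mono[OF st, of "2/3" "3/4"] by (simp add: e_def)
      moreover define k where "k l = (s + t) * Im x / ((e l + e (1 - l)) * y)" for l
      ultimately have "k (3/4) \<noteq> k (2/3)"
        using False st y e[of "3/4"] e[of "1 - 3/4"] e[of "2/3"] e[of "1 - 2/3"] by (simp add: frac_eq_eq)
      moreover have "2 * \<i> * of_real (k (3/4)) * L$1$2 = 2 * \<i> * of_real (k (2/3)) * L$1$2"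
        using L[of "3/4"] L[of "2/3"] by (simp only: k_def)
      ultimately have "L$1$2 = 0"
        by simp
      then have "L$2$1 = 0" "L$1$1 = L$2$2"
        using L[of "3/4"] by auto
      then have "(a - b) * (a - b) = 0"
        using Lspec \<open>L$1$2 = 0\<close> by algebra
      then show False
        using ab by simp
    qed
  qed
  then obtain l where l: "0 < l" "l < 1" "aluthge_limit (1/2) (aluthge l T) \<noteq> aluthge_limit (1/2) T"
    unfolding L_def by blast
  moreover have "T$1$2 \<noteq> 0" "(aluthge l T)$1$2 \<noteq> 0"
    using \<open>\<gamma> \<noteq> 0\<close> y st e[of l] unfolding AT by (simp_all add: T_def rotor_def)
  ultimately show thesis
    using that T by blast
qed

section \<open>Similarity orbits of diagonal matrices\<close>

lemma matrix_inv_eq: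
  fixes A B :: "complex^'n^'n"
  assumes "A ** B = mat 1"
  shows "matrix_inv A = B" "invertible A"
proof -
  have BA: "B ** A = mat 1"
    using assms by (simp add: matrix_left_right_inverse)
  then show "invertible A"
    using assms unfolding invertible_def by blast
  have "A ** matrix_inv A = mat 1 \<and> matrix_inv A ** A = mat 1"
    unfolding matrix_inv_def by (rule someI[of _ B]) (use assms BA in blast)
  then show "matrix_inv A = B"
    by (metis BA matrix_mul_assoc matrix_mul_lid matrix_mul_rid)
qed

text \<open>The columns of \<open>S\<close> are eigenvectors of \<open>T\<close> for a and b. They
  are independent because the off-diagonal entry is nonzero and a and b differ.\<close>

lemma embed2_in_similarity_orbit:
  assumes "i \<noteq> j" "has_spectrum a b T" "T$1$2 \<noteq> 0" "a \<noteq> b" "a * b \<noteq> 0"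
  shows "embed2 i j d T \<in> similarity_orbit (embed2 i j d (mat2 a 0 0 b))"
proof -
  have sp: "T$1$1 + T$2$2 = a + b" "T$1$1 * T$2$2 - T$1$2 * T$2$1 = a * b"
    using assms(2) unfolding has_spectrum_def[OF assms(4,5)] trace_2 det_2 by auto
  define S where "S = mat2 (T$1$2) (T$1$2) (a - T$1$1) (b - T$1$1)"
  have "det S = T$1$2 * (b - a)"
    by (simp add: S_def det_2 algebra_simps)
  then have "invertible S"
    using assms by (simp add: invertible_det_nz)
  then obtain S' where S': "S ** S' = mat 1"
    unfolding invertible_def by blast
  have TS: "T ** S = S ** mat2 a 0 0 b"
    unfolding matrix2_eq_iff mult2_nth S_def using sp by simp algebra
  have "T = S ** mat2 a 0 0 b ** S'"
    unfolding TS[symmetric] using S' by (simp add: matrix_mul_assoc[symmetric])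
  then have "embed2 i j d T = embed2 i j (\<lambda>k. 1) S ** embed2 i j d (mat2 a 0 0 b) ** embed2 i j (\<lambda>k. 1) S'"
    by (simp add: embed2_mult[OF assms(1)])
  moreover have inv: "embed2 i j (\<lambda>k. 1) S ** embed2 i j (\<lambda>k. 1) S' = mat 1"
    using assms(1) S' by (simp add: embed2_mult embed2_one)
  ultimately show ?thesis
    unfolding similarity_orbit_def using matrix_inv_eq[OF inv]
    by (intro CollectI exI[of _ "embed2 i j (\<lambda>k. 1) S"]) simp
qed

lemma diagonal_eigenvalue:
  assumes "is_diagonal D" "is_eigenvalue D c"
  obtains i where "D $ i $ i = c"
proof -
  obtain v where v: "v \<noteq> 0" "D *v v = c *s v"
    using assms(2) unfolding is_eigenvalue_def by blast
  then obtain i where "v $ i \<noteq> 0"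
    by (auto simp: vec_eq_iff)
  have "(D *v v) $ i = (\<Sum>k\<in>{i}. D $ i $ k * v $ k)"
    unfolding matrix_vector_mult_def vec_lambda_beta
    using assms(1) by (intro sum.mono_neutral_right) (auto simp: is_diagonal_def)
  then have "D $ i $ i * v $ i = c * v $ i"
    using v(2) by auto
  then show thesis
    using \<open>v $ i \<noteq> 0\<close> that by (metis mult_right_cancel)
qed

lemma diagonal_invertible_nz:
  fixes D :: "complex^'n^'n"
  assumes "is_diagonal D" "invertible D"
  shows "D $ k $ k \<noteq> 0"
proof
  assume "D $ k $ k = 0"
  obtain D' where "D ** D' = mat 1"
    using assms(2) unfolding invertible_def by blast
  moreover have "(D ** D') $ k $ k = 0"
    using assms(1) \<open>D $ k $ k = 0\<close> unfolding matrix_matrix_mult_def is_diagonal_def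
    by (simp, intro sum.neutral) (metis mult_zero_left)
  ultimately show False
    by (simp add: mat_def)
qed

theorem proposition4p4p2:
  fixes D :: "complex^'n^'n"
  assumes "is_diagonal D" and "invertible D"
    and "\<exists>a b. is_eigenvalue D a \<and> is_eigenvalue D b \<and> cmod a \<noteq> cmod b"
  shows "\<exists>T \<in> similarity_orbit D. \<not> (\<lambda>l. aluthge_limit l T) constant_on {0<..<1}"
proof (rule ccontr)
  assume "\<not> ?thesis"
  then have const: "aluthge_limit l T = aluthge_limit (1/2) T"
    if "T \<in> similarity_orbit D" "0 < l" "l < 1" for T l
    using that unfolding constant_on_def by fastforce
  obtain i j where "cmod (D$i$i) \<noteq> cmod (D$j$j)"
    using assms(3) diagonal_eigenvalue[OF assms(1)] by metis
  then obtain i j where ij: "cmod (D$j$j) < cmod (D$i$i)"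
    by (metis linorder_neqE_linordered_idom)
  then have "i \<noteq> j" by auto
  define a b d where "a = D$i$i" and "b = D$j$j" and "d = (\<lambda>k. D$k$k)"
  have d: "d k \<noteq> 0" for k
    using diagonal_invertible_nz[OF assms(1,2)] by (simp add: d_def)
  have ab: "b \<noteq> 0" "cmod b < cmod a" "a \<noteq> b" "a * b \<noteq> 0"
    using ij d by (auto simp: a_def b_def d_def)
  have D: "D = embed2 i j d (mat2 a 0 0 b)"
    using assms(1) \<open>i \<noteq> j\<close> by (auto simp: vec_eq_iff embed2_def is_diagonal_def a_def b_def d_def)
  obtain T l where T: "has_spectrum a b T" "T$1$2 \<noteq> 0" "(aluthge l T)$1$2 \<noteq> 0" and l: "0 < l" "l < 1"
    and neq: "aluthge_limit (1/2) (aluthge l T) \<noteq> aluthge_limit (1/2) T"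
    using aluthge_limit_not_constant_2[OF ab(1,2)] by metis
  let ?E = "embed2 i j d"
  note T' = has_spectrum_aluthge[OF ab(3,4) T(1)]
  \<comment> \<open>Constancy is assumed on the whole orbit and used for these two members; the
    argument does not decide for which of them it fails.\<close>
  have orb: "?E T \<in> similarity_orbit D" "?E (aluthge l T) \<in> similarity_orbit D"
    unfolding D using embed2_in_similarity_orbit[OF \<open>i \<noteq> j\<close> _ _ ab(3,4)] T T' by auto
  \<comment> \<open>Constancy changes the parameter from 1/2 to \<open>l\<close>, where dropping one
    transform leaves the limit unchanged, and then changes it back.\<close>
  have "?E (aluthge_limit (1/2) (aluthge l T)) = aluthge_limit (1/2) (?E (aluthge l T))"
    using aluthge_limit_embed2[OF ab(3,4) T' \<open>i \<noteq> j\<close> d] by simp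
  also have "\<dots> = aluthge_limit l (?E (aluthge l T))"
    using const[OF orb(2) l] by simp
  also have "\<dots> = aluthge_limit l (aluthge l (?E T))"
    using aluthge_embed2[OF \<open>i \<noteq> j\<close> has_spectrum_det[OF ab(3,4) T(1)] d] by simp
  also have "\<dots> = aluthge_limit l (?E T)"
    by (rule aluthge_limit_aluthge)
  also have "\<dots> = aluthge_limit (1/2) (?E T)"
    by (rule const[OF orb(1) l])
  also have "\<dots> = ?E (aluthge_limit (1/2) T)"
    by (rule aluthge_limit_embed2[OF ab(3,4) T(1) \<open>i \<noteq> j\<close> d])
  finally show False
    using neq embed2_inject[OF \<open>i \<noteq> j\<close>] by blast
qed

end
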